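(* Let $n$ be an integer and let $T_{2n}$ be the two-bridge knot with Conway's notation $C(2n,3)$. Then the $A$-polynomial $A_{2n}=A_{2n}(L,M)$ of $T_{2n}$ is given explicitly by \[ A_{2n}=\sum_{i=0}^{2n}\binom{n+\lfloor i/2\rfloor}{i}\left(\frac{(LM^{4n}-1)(1-M^{2})}{1+LM^{2+4n}}\right)^{i}\left(\frac{1+LM^{6+4n}}{M^{2}+LM^{4+4n}}\right)^{\lfloor (1+i)/2\rfloor} M^{-2n}\left(1+LM^{2+4n}\right)^{3n} \] if $n\ge 0$, and \[ A_{2n}=\sum_{i=0}^{-2n-1}\binom{-n+\lfloor (i-1)/2\rfloor}{i}\left(\frac{(1-M^{2})(M^{-4n}-L)}{LM^{2}+M^{-4n}}\right)^{i}\left(\frac{LM^{6}+M^{-4n}}{LM^{4}+M^{2-4n}}\right)^{\lfloor (1+i)/2\rfloor} M^{8n+6}\left(LM^{2}+M^{-4n}\right)^{-3n-1} \] if $n<0$.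
   Context: The knot $T_{2n}$ with Conway's notation $C(2n,3)$ is the two-bridge knot whose diagram consists of a twist region with $2n$ half-twists followed by a twist region with $3$ half-twists (for $n<0$ the first twist region has $|2n|$ half-twists of the opposite sense); it is the mirror image of the double twist knot $J[3,-2n]$. Its exterior $X_{2n}$ has fundamental group $\langle s,t\mid swt^{-1}w^{-1}=1\rangle$ with $w=(ts^{-1}tst^{-1}s)^n$, where $s,t$ are meridians, and $l=ww^{*}s^{-4n}$ (with $w^*$ the word $w$ written in reverse) is the null-homologous longitude. The $A$-polynomial $A(L,M)$ (Cooper–Culler–Gillet–Long–Shalen) of a knot exterior is the polynomial defining the closure of the set of pairs $(L,M)\in(\mathbb{C}^* )^2$ such that there is a nonabelian representation $\rho:\pi_1(X_{2n})\to \mathrm{SL}(2,\mathbb{C})$ with $\rho(s)$, $\rho(l)$ upper triangular having upper-left entries $M$ and $L$ respectively (eigenvalues of meridian and longitude); it is defined up to multiplication by a nonzero constant, and the formula above gives the normalized representative (a polynomial with no monomial factor). Here $\binom{a}{b}$ denotes the usual binomial coefficient and $\lfloor\cdot\rfloor$ the floor function. *)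

theory Defs
  imports "HOL-Analysis.Analysis" "HOL-Computational_Algebra.Polynomial"
begin

(* Words in the free group on s,t: letters 1 = s, -1 = s^-1, 2 = t, -2 = t^-1 *)
definition word_inv :: "int list \<Rightarrow> int list" where
  "word_inv u = rev (map uminus u)"

definition word_u :: "int list" where
  "word_u = [2, -1, 2, 1, -2, 1]"

definition word_w :: "int \<Rightarrow> int list" where
  "word_w n = (if n \<ge> 0 then concat (replicate (nat n) word_u)
               else concat (replicate (nat (- n)) (word_inv word_u)))"

definition word_spow :: "int \<Rightarrow> int list" where
  "word_spow k = (if k \<ge> 0 then replicate (nat k) 1 else replicate (nat (- k)) (-1))"

definition relator :: "int \<Rightarrow> int list" where
  "relator n = [1] @ word_w n @ [-2] @ word_inv (word_w n)"

definition longitude :: "int \<Rightarrow> int list" where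
  "longitude n = word_w n @ rev (word_w n) @ word_spow (-4 * n)"

definition letter_val :: "complex^2^2 \<Rightarrow> complex^2^2 \<Rightarrow> int \<Rightarrow> complex^2^2" where
  "letter_val S T x = (if x = 1 then S else if x = -1 then matrix_inv S
                       else if x = 2 then T else matrix_inv T)"

fun word_val :: "complex^2^2 \<Rightarrow> complex^2^2 \<Rightarrow> int list \<Rightarrow> complex^2^2" where
  "word_val S T [] = mat 1"
| "word_val S T (x # xs) = letter_val S T x ** word_val S T xs"

(* A representation rho : pi_1(X_{2n}) \<rightarrow> SL(2,C) is determined by S = rho(s), T = rho(t)
   in SL(2,C) satisfying the relator; it is nonabelian iff S and T do not commute. *)
definition nonabelian_rep :: "int \<Rightarrow> complex^2^2 \<Rightarrow> complex^2^2 \<Rightarrow> bool" where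
  "nonabelian_rep n S T \<longleftrightarrow> det S = 1 \<and> det T = 1 \<and> word_val S T (relator n) = mat 1
      \<and> S ** T \<noteq> T ** S"

definition eig_set :: "int \<Rightarrow> (complex \<times> complex) set" where
  "eig_set n = {(L, M). \<exists>S T. nonabelian_rep n S T
      \<and> S $ 2 $ 1 = 0 \<and> S $ 1 $ 1 = M
      \<and> word_val S T (longitude n) $ 2 $ 1 = 0 \<and> word_val S T (longitude n) $ 1 $ 1 = L}"

(* bivariate polynomials: complex poly poly, outer variable M, inner variable L *)
definition beval :: "complex poly poly \<Rightarrow> complex \<Rightarrow> complex \<Rightarrow> complex" where
  "beval P L M = poly (poly P [:M:]) L"

(* P is the A-polynomial: it generates the ideal of all polynomials vanishing on the set
   of eigenvalue pairs, i.e. it defines the Zariski closure of that set (up to a constant). *)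
definition is_A_polynomial :: "int \<Rightarrow> complex poly poly \<Rightarrow> bool" where
  "is_A_polynomial n P \<longleftrightarrow>
     (\<forall>Q. (\<forall>(L, M) \<in> eig_set n. beval Q L M = 0) \<longleftrightarrow> P dvd Q)"

definition A_formula :: "int \<Rightarrow> complex \<Rightarrow> complex \<Rightarrow> complex" where
  "A_formula n L M =
    (if n \<ge> 0 then
      (\<Sum>i\<in>{0..nat (2*n)}.
         of_nat ((nat n + i div 2) choose i)
         * (((L * M powi (4*n) - 1) * (1 - M^2)) / (1 + L * M powi (2 + 4*n))) ^ i
         * ((1 + L * M powi (6 + 4*n)) / (M^2 + L * M powi (4 + 4*n))) ^ ((1 + i) div 2)
         * M powi (-2*n) * (1 + L * M powi (2 + 4*n)) powi (3*n))
     else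
      (\<Sum>i\<in>{0..nat (-2*n - 1)}.
         of_nat (nat (- n + (int i - 1) div 2) choose i)
         * (((1 - M^2) * (M powi (-4*n) - L)) / (L * M^2 + M powi (-4*n))) ^ i
         * ((L * M^6 + M powi (-4*n)) / (L * M^4 + M powi (2 - 4*n))) ^ ((1 + i) div 2)
         * M powi (8*n + 6) * (L * M^2 + M powi (-4*n)) powi (-3*n - 1)))"

definition formula_defined :: "int \<Rightarrow> complex \<Rightarrow> complex \<Rightarrow> bool" where
  "formula_defined n L M \<longleftrightarrow> M \<noteq> 0 \<and>
    (if n \<ge> 0 then 1 + L * M powi (2 + 4*n) \<noteq> 0 \<and> M^2 + L * M powi (4 + 4*n) \<noteq> 0
     else L * M^2 + M powi (-4*n) \<noteq> 0 \<and> L * M^4 + M powi (2 - 4*n) \<noteq> 0)"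

end

theory Submission
  imports Defs "HOL-Computational_Algebra.Fundamental_Theorem_Algebra"
begin

text \<open>
  Put \<open>x = M\<^sup>2 + M\<^sup>-\<^sup>2\<close>, \<open>y = tr (ST) - 2\<close> and \<open>X = x - 1 - y\<close>. The matrix \<open>U\<close> of
  \<open>ts\<^sup>-\<^sup>1tst\<^sup>-\<^sup>1s\<close> has trace \<open>t = X\<^sup>2y + 2\<close> and satisfies \<open>SU - UT = k (S - T)\<close> with the scalar
  \<open>k = t - 1 + Xy\<close>. Writing \<open>W = U\<^sup>n\<close> with Chebyshev polynomials, \<open>SW = WT\<close> becomes a single
  scalar equation, the Riley equation in \<open>x, y\<close>; on its zero set \<open>WW\<^sup>*\<close> is a combination of
  \<open>1\<close> and \<open>S\<close>, and its eigenvalue \<open>l = LM\<^bsup>4n\<^esup>\<close> satisfies \<open>l (M\<^sup>2y - M\<^sup>4) = M\<^sup>-\<^sup>2 - y\<close>. Solving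
  this for \<open>y\<close> and substituting into the Riley polynomial gives the formula.

  For the ideal statement, a polynomial vanishing on all eigenvalue pairs is divided by the
  formula as a polynomial in \<open>L\<close>. The remainder vanishes because for infinitely many \<open>M\<close> the
  Riley polynomial has as many distinct roots as its degree: its values at real \<open>y\<close> alternate
  in sign at the dihedral point \<open>x = -2\<close>, hence also for nearby \<open>x\<close>. The leading coefficient can be
  cancelled since the formula is not divisible by any polynomial in \<open>M\<close> alone.
\<close>

section \<open>Matrices in the algebra generated by two meridians\<close>

text \<open>By Cayley--Hamilton, \<open>1, S, T, ST\<close> span a subalgebra, so words in \<open>S\<close> and \<open>T\<close> can be
  computed in these four coordinates, whose structure constants only involve the traces.\<close>
definition lincomb :: "complex^2^2 \<Rightarrow> complex^2^2 \<Rightarrow> complex \<Rightarrow> complex \<Rightarrow> complex \<Rightarrow> complex \<Rightarrow> complex^2^2" where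
  "lincomb S T a b c d = (\<chi> i j. a * mat 1 $ i $ j + b * S $ i $ j + c * T $ i $ j + d * (S ** T) $ i $ j)"

lemma mat2_eq_iff: "(A :: 'a^2^2) = B \<longleftrightarrow> A$1$1 = B$1$1 \<and> A$1$2 = B$1$2 \<and> A$2$1 = B$2$1 \<and> A$2$2 = B$2$2"
  by (auto simp: vec_eq_iff forall_2)

lemma mat2_mult:
  fixes A B :: "'a::semiring_1^2^2"
  shows "(A ** B) $ i $ j = A$i$1 * B$1$j + A$i$2 * B$2$j"
  by (simp add: matrix_matrix_mult_def sum_2)

lemma mat2_one [simp]: "(mat 1 :: 'a::semiring_1^2^2) $ 1 $ 1 = 1" "(mat 1 :: 'a^2^2) $ 1 $ 2 = 0"
  "(mat 1 :: 'a^2^2) $ 2 $ 1 = 0" "(mat 1 :: 'a^2^2) $ 2 $ 2 = 1"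
  by (auto simp: mat_def)

lemma matrix_inv_eqI:
  fixes A B :: "'a::field^'n^'n"
  assumes "A ** B = mat 1"
  shows "matrix_inv A = B"
proof -
  have "B ** A = mat 1" using assms by (simp add: matrix_left_right_inverse)
  then have "A ** matrix_inv A = mat 1 \<and> matrix_inv A ** A = mat 1"
    unfolding matrix_inv_def using assms by (intro someI_ex[where P = "\<lambda>C. A ** C = mat 1 \<and> C ** A = mat 1"]) blast
  then show ?thesis using assms
    by (metis matrix_mul_assoc matrix_mul_lid matrix_mul_rid)
qed

lemma matrix_inv_mat2:
  fixes A :: "complex^2^2"
  assumes "det A = 1"
  shows "matrix_inv A = (\<chi> i j. (A$1$1 + A$2$2) * mat 1 $ i $ j - A $ i $ j)"
  using assms by (intro matrix_inv_eqI) (simp add: mat2_eq_iff mat2_mult det_2 algebra_simps)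

text \<open>The images of the meridians are conjugate, hence the common trace \<open>h\<close>.
  Coordinates of words depend only on \<open>h\<close> and \<open>y\<close>.\<close>

locale sl2_pair =
  fixes S T :: "complex^2^2" and h y :: complex
  assumes detS: "det S = 1" and detT: "det T = 1"
    and trS: "S$1$1 + S$2$2 = h" and trT: "T$1$1 + T$2$2 = h"
    and trST: "(S ** T)$1$1 + (S ** T)$2$2 = y + 2"
begin

lemma lincomb_S_mult: "S ** lincomb S T a b c d = lincomb S T (- b) (a + h*b) (- d) (c + h*d)"
proof -
  have "S$1$1 * S$2$2 - S$1$2*S$2$1 = 1" using detS by (simp add: det_2)
  then show ?thesis unfolding trS[symmetric]
    apply (simp add: mat2_eq_iff mat2_mult lincomb_def)
    apply (intro conjI; algebra)
    done
qed

lemma lincomb_T_mult: "T ** lincomb S T a b c d =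
  lincomb S T (- h*d - c + b*(y + 2 - h*h)) (h*b + d) (a + h*b + h*c + (y+2)*d) (- b)"
proof -
  have "S$1$1 * S$2$2 - S$1$2*S$2$1 = 1" using detS by (simp add: det_2)
  moreover have "T$1$1 * T$2$2 - T$1$2*T$2$1 = 1" using detT by (simp add: det_2)
  moreover have "S$2$2 = h - S$1$1" "T$2$2 = h - T$1$1" using trS trT by (auto simp: algebra_simps)
  moreover have "S$1$1*T$1$1+S$1$2*T$2$1 + S$2$1*T$1$2+S$2$2*T$2$2 = y + 2"
    using trST by (simp add: mat2_mult algebra_simps)
  ultimately show ?thesis 
    apply (simp add: mat2_eq_iff mat2_mult lincomb_def)
    apply (intro conjI; algebra)
    done
qed

lemma lincomb_mult_T: "lincomb S T a b c d ** T = lincomb S T (- c) (- d) (a + h*c) (b + h*d)"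
proof -
  have "T$1$1 * T$2$2 - T$1$2*T$2$1 = 1" using detT by (simp add: det_2)
  then show ?thesis unfolding trT[symmetric]
    apply (simp add: mat2_eq_iff mat2_mult lincomb_def)
    apply (intro conjI; algebra)
    done
qed

text \<open>Rewrite rules that evaluate a word letter by letter; inverses come from
  \<open>A^-1 = tr A - A\<close> for determinant 1.\<close>

lemma letter_lincomb:
  "letter_val S T 1 ** lincomb S T a b c d = lincomb S T (- b) (a + h*b) (- d) (c + h*d)"
  "letter_val S T (-1) ** lincomb S T a b c d = lincomb S T (h*a + b) (- a) (h*c + d) (- c)"
  "letter_val S T 2 ** lincomb S T a b c d =
    lincomb S T (- h*d - c + b*(y + 2 - h*h)) (h*b + d) (a + h*b + h*c + (y+2)*d) (- b)"
  "letter_val S T (-2) ** lincomb S T a b c d =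
    lincomb S T (h*a + h*d + c - b*(y + 2 - h*h)) (- d) (- a - h*b - (y+2)*d) (h*d + b)"
proof -
  have inv: "(\<chi> i j. h * mat 1 $ i $ j - A $ i $ j) ** B = (\<chi> i j. h * B $ i $ j - (A ** B) $ i $ j)"
    for A B :: "complex^2^2"
    by (simp add: mat2_eq_iff mat2_mult algebra_simps)
  show "letter_val S T 1 ** lincomb S T a b c d = lincomb S T (- b) (a + h*b) (- d) (c + h*d)"
    by (simp add: letter_val_def lincomb_S_mult)
  show "letter_val S T 2 ** lincomb S T a b c d =
    lincomb S T (- h*d - c + b*(y + 2 - h*h)) (h*b + d) (a + h*b + h*c + (y+2)*d) (- b)"
    by (simp add: letter_val_def lincomb_T_mult)
  show "letter_val S T (-1) ** lincomb S T a b c d = lincomb S T (h*a + b) (- a) (h*c + d) (- c)"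
    by (simp add: letter_val_def matrix_inv_mat2[OF detS] trS inv lincomb_S_mult)
      (simp add: lincomb_def vec_eq_iff algebra_simps)
  show "letter_val S T (-2) ** lincomb S T a b c d =
    lincomb S T (h*a + h*d + c - b*(y + 2 - h*h)) (- d) (- a - h*b - (y+2)*d) (h*d + b)"
    by (simp add: letter_val_def matrix_inv_mat2[OF detT] trT inv lincomb_T_mult)
      (simp add: lincomb_def vec_eq_iff algebra_simps)
qed

lemma mat_1_lincomb: "mat 1 = lincomb S T 1 0 0 0"
  by (simp add: lincomb_def vec_eq_iff)

abbreviation U where "U \<equiv> word_val S T word_u"
abbreviation U' where "U' \<equiv> word_val S T (rev word_u)"
text \<open>This is \<open>tr (S T^-1) - 1\<close>, because
  \<open>tr S tr T = tr (ST) + tr (S T^-1)\<close>.\<close>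

definition X where "X = h\<^sup>2 - 3 - y"
definition t where "t = X\<^sup>2 * y + 2"
definition k where "k = t - 1 + X*y"

lemma U_lincomb: "U = lincomb S T (4 + 10*y + 6*y^2 + y^3 - 10*h^2 - 12*h^2*y - 3*h^2*y^2 + 6*h^4 + 3*h^4*y - h^6)
  (h*(6+5*y+y^2) - h^3*(5+2*y) + h^5)
  (h*(6+5*y+y^2) - h^3*(5+2*y) + h^5)
  (- 3 - 4*y - y^2 + h^2*(4+2*y) - h^4)"
  unfolding word_u_def word_val.simps mat_1_lincomb letter_lincomb
  by (rule arg_cong4[where f = "lincomb S T"]; (simp; algebra))

lemma U'_lincomb: "U' = lincomb S T (h^2-y-2) (h*(3+y)-h^3) (h*(3+y)-h^3) (3 + 4*y + y^2 - h^2*(4+2*y) + h^4)"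
  unfolding word_u_def rev.simps append.simps word_val.simps mat_1_lincomb letter_lincomb
  by (rule arg_cong4[where f = "lincomb S T"]; (simp; algebra))

lemma trace_lincomb: "lincomb S T a b c d $1$1 + lincomb S T a b c d $2$2 = 2*a + h*b+h*c+(y+2)*d"
proof -
  have "lincomb S T a b c d $1$1 + lincomb S T a b c d $2$2 =
    2*a + b*(S$1$1 + S$2$2) + c*(T$1$1 + T$2$2) + d*((S ** T)$1$1 + (S ** T)$2$2)"
    by (simp add: lincomb_def algebra_simps)
  then show ?thesis by (simp only: trS trT trST mult.commute)
qed

lemma trace_U: "U$1$1 + U$2$2 = t"
  unfolding U_lincomb trace_lincomb t_def X_def by algebra

lemma trace_U': "U'$1$1 + U'$2$2 = t"
  unfolding U'_lincomb trace_lincomb t_def X_def by algebra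

lemma lincomb_minus: "lincomb S T a b c d - lincomb S T a' b' c' d' = lincomb S T (a-a') (b-b') (c-c') (d-d')"
  by (simp add: lincomb_def vec_eq_iff algebra_simps)

text \<open>The coordinates of \<open>U\<close> along \<open>S\<close> and \<open>T\<close> agree,
  so in \<open>SU - UT\<close> the parts along \<open>1\<close> and \<open>ST\<close> cancel and
  those along \<open>S\<close> and \<open>T\<close> are opposite.\<close>

lemma SU_minus_UT: "S ** U - U ** T = (\<chi> i j. k * (S $ i $ j - T $ i $ j))"
proof -
  have "S ** U - U ** T = lincomb S T 0 k (-k) 0"
  unfolding U_lincomb lincomb_S_mult lincomb_mult_T lincomb_minus k_def t_def X_def
  by (rule arg_cong4[where f = "lincomb S T"]; algebra)
  then show ?thesis by (simp add: lincomb_def vec_eq_iff algebra_simps)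
qed

definition n0 where "n0 = X\<^sup>2 * y * (h\<^sup>2 * (X + 1)\<^sup>2 - (X + 2)\<^sup>2)"
definition n1 where "n1 = - (X ^ 3 * y * h * (X + 2))"

text \<open>The left side is \<open>(U - k)(U' - k)\<close>. On the zero set of the Riley
  polynomial, \<open>W\<close> and its reverse are the same scalar times \<open>U - k\<close> and
  \<open>U' - k\<close>.\<close>

lemma UU'_lincomb: "(\<chi> i j. (U ** U')$i$j - k * (U$i$j + U'$i$j) + k^2 * mat 1 $ i $ j) = lincomb S T n0 n1 0 0"
proof -
  have 2: "word_val S T word_u ** lincomb S T a b c d = letter_val S T 2 ** (letter_val S T (-1) ** (letter_val S T 2 ** (letter_val S T 1 ** (letter_val S T (-2) ** (letter_val S T 1 ** lincomb S T a b c d)))))" for a b c d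
    unfolding word_u_def word_val.simps by (simp add: matrix_mul_assoc)
  have 3: "U ** U' = lincomb S T
     (n0 + k * ((4 + 10*y + 6*y^2 + y^3 - 10*h^2 - 12*h^2*y - 3*h^2*y^2 + 6*h^4 + 3*h^4*y - h^6) + (h^2-y-2)) - k^2)
     (n1 + k * ((h*(6+5*y+y^2) - h^3*(5+2*y) + h^5) + (h*(3+y)-h^3)))
     (k * ((h*(6+5*y+y^2) - h^3*(5+2*y) + h^5) + (h*(3+y)-h^3))) 0"
    unfolding U'_lincomb 2 letter_lincomb n0_def n1_def k_def t_def X_def
    by (rule arg_cong4[where f = "lincomb S T"]; algebra)
  show ?thesis
    unfolding 3 unfolding U'_lincomb U_lincomb
    by (simp add: lincomb_def vec_eq_iff algebra_simps)
qed

end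

section \<open>Chebyshev polynomials and powers of words\<close>

text \<open>The Chebyshev polynomials \<open>S\<^bsub>n-1\<^esub>(t)\<close>, for which \<open>A\<^sup>n = cheb n t A - cheb (n - 1) t\<close>
  whenever \<open>det A = 1\<close> and \<open>tr A = t\<close>.\<close>
fun cheb_nat :: "nat \<Rightarrow> 'a::comm_ring_1 \<Rightarrow> 'a" where
  "cheb_nat 0 t = 0"
| "cheb_nat (Suc 0) t = 1"
| "cheb_nat (Suc (Suc k)) t = t * cheb_nat (Suc k) t - cheb_nat k t"

definition cheb :: "int \<Rightarrow> 'a::comm_ring_1 \<Rightarrow> 'a" where
  "cheb n t = (if n \<ge> 0 then cheb_nat (nat n) t else - cheb_nat (nat (- n)) t)"

lemma cheb_0 [simp]: "cheb 0 t = 0" and cheb_1 [simp]: "cheb 1 t = 1"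
  by (simp_all add: cheb_def)

lemma cheb_minus: "cheb (- n) t = - cheb n t"
  by (auto simp: cheb_def)

lemma cheb_of_nat: "cheb (int k) t = cheb_nat k t"
  by (simp add: cheb_def)

lemma cheb_rec: "cheb (n + 1) t = t * cheb n t - cheb (n - 1) t"
proof -
  have pos: "cheb (int k + 1) t = t * cheb (int k) t - cheb (int k - 1) t" for k
  proof (cases k)
    case 0
    then show ?thesis by (simp add: cheb_def)
  next
    case (Suc j)
    have "nat (2 + int j) = Suc (Suc j)" "nat (1 + int j) = Suc j" by auto
    then show ?thesis by (simp add: Suc cheb_def)
  qed
  show ?thesis
  proof (cases "n \<ge> 0")
    case True
    then show ?thesis using pos[of "nat n"] by simp
  next
    case False
    then have "cheb (- n + 1) t = t * cheb (- n) t - cheb (- n - 1) t"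
      using pos[of "nat (- n)"] by simp
    moreover have "- n + 1 = - (n - 1)" "- n - 1 = - (n + 1)" by auto
    ultimately have "- cheb (n - 1) t = t * - cheb n t - - cheb (n + 1) t"
      by (metis cheb_minus)
    then show ?thesis by (simp add: algebra_simps)
  qed
qed

lemma int_bidir_induct [case_names base step pred]:
  fixes P :: "int \<Rightarrow> bool"
  assumes "P 0" "\<And>n. P n \<Longrightarrow> P (n + 1)" "\<And>n. P (n + 1) \<Longrightarrow> P n"
  shows "P n"
proof (induction n rule: int_induct[where k = 0])
  case (step2 i)
  then show ?case using assms(3)[of "i - 1"] by simp
qed (use assms in auto)

text \<open>The recurrence preserves this quadratic form; the value 1 reflects
  \<open>det (A^n) = 1\<close>.\<close>

lemma cheb_det: "cheb n t ^ 2 - t * cheb n t * cheb (n - 1) t + cheb (n - 1) t ^ 2 = 1"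
proof -
  have shift: "(t * b - c)^2 - t * (t * b - c) * b + b^2 = b^2 - t * b * c + c^2" for b c :: 'a
    by (simp add: power2_eq_square algebra_simps)
  have rec: "cheb (n + 1) t ^ 2 - t * cheb (n + 1) t * cheb (n + 1 - 1) t + cheb (n + 1 - 1) t ^ 2
    = cheb n t ^ 2 - t * cheb n t * cheb (n - 1) t + cheb (n - 1) t ^ 2" for n
    using shift[of "cheb n t" "cheb (n - 1) t"] by (simp only: cheb_rec add_diff_cancel_right')
  show ?thesis
  proof (induction n rule: int_bidir_induct)
    case base
    then show ?case by (simp add: cheb_def)
  qed (simp_all only: rec)
qed

text \<open>As \<open>m\<close> is a root of \<open>z^2 - t z + 1\<close> with
  \<open>t = m + 1/m\<close>, raising \<open>n\<close> by one divides the difference by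
  \<open>m\<close>. This avoids the closed form, whose denominator \<open>m - 1/m\<close> may
  vanish.\<close>

lemma cheb_at_sum_inverse:
  fixes m :: "'a::field"
  assumes "m \<noteq> 0"
  shows "cheb (n + 1) (m + 1/m) - m * cheb n (m + 1/m) = m powi (- n)"
proof -
  define e where "e n = cheb (n + 1) (m + 1/m) - m * cheb n (m + 1/m)" for n
  have rec: "m * e (n + 1) = e n" for n
  proof -
    have "m * (m + 1/m) = m * m + 1" using assms by (simp add: field_simps)
    then show ?thesis unfolding e_def cheb_rec[of "n + 1"] by simp algebra
  qed
  have "e n = m powi (- n)"
  proof (induction n rule: int_bidir_induct)
    case base
    then show ?case by (simp add: e_def)
  next
    case (step n)
    have "m * e (n + 1) = m * m powi (- (n + 1))"
      using assms step by (simp add: rec power_int_diff)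
    then show ?case using assms by simp
  next
    case (pred n)
    have "e n = m * m powi (- (n + 1))" using rec[of n] pred by simp
    then show ?case using assms by (simp add: power_int_diff)
  qed
  then show ?thesis by (simp add: e_def)
qed

text \<open>The Riley polynomial in \<open>x = M\<^sup>2 + M\<^sup>-\<^sup>2\<close> and \<open>y = tr (ST) - 2\<close>.\<close>
definition riley :: "int \<Rightarrow> 'a::comm_ring_1 \<Rightarrow> 'a \<Rightarrow> 'a" where
  "riley n x y = cheb (n + 1) ((x - 1 - y)^2 * y + 2) - cheb n ((x - 1 - y)^2 * y + 2)
     + (x - 1 - y) * y * cheb n ((x - 1 - y)^2 * y + 2)"

text \<open>At \<open>y = m\<close> one has \<open>t = m + 1/m\<close> and
  \<open>X y = 1 - m\<close>. With \<open>m = M^2\<close> and \<open>m = 1/M^2\<close> this shows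
  that the pole and the zero of the Moebius map from \<open>y\<close> to \<open>l\<close> are never
  Riley roots.\<close>

lemma riley_at_root:
  fixes m :: "'a::field"
  assumes "m \<noteq> 0"
  shows "riley n (m + 1/m) m = m powi (- n)"
proof -
  have t: "(m + 1/m - 1 - m)^2 * m + 2 = m + 1/m"
    and c: "(m + 1/m - 1 - m) * m = 1 - m"
    using assms by (simp_all add: power2_eq_square field_simps)
  show ?thesis unfolding riley_def t c cheb_at_sum_inverse[OF assms, symmetric] by (simp add: algebra_simps)
qed

section \<open>Powers of words\<close>

definition word_power :: "int \<Rightarrow> int list \<Rightarrow> int list" where
  "word_power n u = (if n \<ge> 0 then concat (replicate (nat n) u)
               else concat (replicate (nat (- n)) (word_inv u)))"

lemma word_w_eq: "word_w n = word_power n word_u"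
  by (simp add: word_w_def word_power_def)

lemma rev_concat_replicate: "rev (concat (replicate k u)) = concat (replicate k (rev u))"
  by (simp add: rev_concat)

lemma rev_word_power: "rev (word_power n u) = word_power n (rev u)"
  by (simp add: word_power_def rev_concat_replicate word_inv_def rev_map)

lemma word_val_append: "word_val S T (u @ v) = word_val S T u ** word_val S T v"
  by (induction u) (simp_all add: matrix_mul_assoc)

lemma det_matrix_inv_mat2: "det A = 1 \<Longrightarrow> det (matrix_inv A) = 1" for A :: "complex^2^2"
  by (simp add: matrix_inv_mat2) (simp add: det_2 algebra_simps)

lemma det_word_val:
  assumes "det S = 1" "det T = 1"
  shows "det (word_val S T u) = 1"
  by (induction u) (auto simp: det_mul letter_val_def assms det_matrix_inv_mat2)

lemma mat2_mult_matrix_inv: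
  fixes A :: "complex^2^2"
  assumes "det A = 1"
  shows "A ** matrix_inv A = mat 1" "matrix_inv A ** A = mat 1"
proof -
  show "A ** matrix_inv A = mat 1"
    using assms by (simp add: matrix_inv_mat2) (simp add: mat2_eq_iff mat2_mult det_2 algebra_simps)
  then show "matrix_inv A ** A = mat 1" by (simp add: matrix_left_right_inverse)
qed

text \<open>\<open>letter_val\<close> sends every integer other than 1, -1 and 2 to the inverse of
  \<open>T\<close>, so negating an entry inverts its matrix only for genuine letters.\<close>

lemma word_val_word_inv:
  assumes "det S = 1" "det T = 1" "set u \<subseteq> {1, -1, 2, -2}"
  shows "word_val S T (word_inv u) = matrix_inv (word_val S T u)"
  using assms(3)
proof (induction u)
  case Nil
  have "matrix_inv (mat 1) = (mat 1 :: complex^2^2)" by (intro matrix_inv_eqI) simp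
  then show ?case by (simp add: word_inv_def)
next
  case (Cons a u)
  have det: "det (letter_val S T a) = 1" by (simp add: letter_val_def assms det_matrix_inv_mat2)
  have inv: "letter_val S T (- a) = matrix_inv (letter_val S T a)"
  proof -
    have ii: "matrix_inv (matrix_inv A) = A" if "det A = 1" for A :: "complex^2^2"
      by (intro matrix_inv_eqI mat2_mult_matrix_inv that)
    show ?thesis using Cons.prems assms by (auto simp: letter_val_def ii)
  qed
  have "matrix_inv (letter_val S T a ** word_val S T u)
    = matrix_inv (word_val S T u) ** matrix_inv (letter_val S T a)"
  proof (rule matrix_inv_eqI)
    have "letter_val S T a ** word_val S T u ** (matrix_inv (word_val S T u) ** matrix_inv (letter_val S T a))
      = letter_val S T a ** (word_val S T u ** matrix_inv (word_val S T u)) ** matrix_inv (letter_val S T a)"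
      by (simp add: matrix_mul_assoc)
    also have "\<dots> = mat 1"
      by (simp add: mat2_mult_matrix_inv det det_word_val assms)
    finally show "letter_val S T a ** word_val S T u ** (matrix_inv (word_val S T u) ** matrix_inv (letter_val S T a)) = mat 1" .
  qed
  then show ?case using Cons inv by (simp add: word_inv_def word_val_append)
qed

lemma word_val_concat_replicate:
  assumes "det (word_val S T u) = 1" and tr: "word_val S T u $ 1 $ 1 + word_val S T u $ 2 $ 2 = t"
  shows "word_val S T (concat (replicate k u)) =
    (\<chi> i j. cheb (int k) t * word_val S T u $ i $ j - cheb (int k - 1) t * mat 1 $ i $ j)"
proof (induction k)
  case 0
  then show ?case by (simp add: vec_eq_iff cheb_def)
next
  case (Suc k)
  define A where "A = word_val S T u"
  have d: "A$1$1 * A$2$2 - A$1$2 * A$2$1 = 1" using assms(1) by (simp add: A_def det_2)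
  have t: "t = A$1$1 + A$2$2" using tr by (simp add: A_def)
  \<comment> \<open>Cayley-Hamilton turns multiplication by \<open>A\<close> into the Chebyshev
    recurrence.\<close>
  have AA: "A ** A = (\<chi> i j. t * A $ i $ j - mat 1 $ i $ j)"
    using d unfolding t by (simp add: mat2_eq_iff mat2_mult) algebra
  have "A ** (\<chi> i j. c * A $ i $ j - c' * mat 1 $ i $ j) = (\<chi> i j. (t * c - c') * A $ i $ j - c * mat 1 $ i $ j)" for c c'
  proof -
    have "A ** (\<chi> i j. c * A $ i $ j - c' * mat 1 $ i $ j) = (\<chi> i j. c * (A ** A) $ i $ j - c' * A $ i $ j)"
      by (simp add: mat2_eq_iff mat2_mult algebra_simps)
    then show ?thesis unfolding AA by (simp add: vec_eq_iff algebra_simps)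
  qed
  then show ?case
    using cheb_rec[of "int k" t] by (simp add: word_val_append Suc A_def[symmetric] add.commute)
qed

lemma word_val_word_power:
  assumes "det S = 1" "det T = 1" "set u \<subseteq> {1, -1, 2, -2}" and tr: "word_val S T u $ 1 $ 1 + word_val S T u $ 2 $ 2 = t"
  shows "word_val S T (word_power n u) =
    (\<chi> i j. cheb n t * word_val S T u $ i $ j - cheb (n - 1) t * mat 1 $ i $ j)"
proof (cases "n \<ge> 0")
  case True
  then show ?thesis
    using word_val_concat_replicate[OF det_word_val[OF assms(1,2)] tr, of "nat n"] by (simp add: word_power_def)
next
  case False
  define A where "A = word_val S T u"
  have det: "det A = 1" by (simp add: A_def det_word_val assms)
  have inv: "word_val S T (word_inv u) = (\<chi> i j. t * mat 1 $ i $ j - A $ i $ j)"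
    using word_val_word_inv[OF assms(1,2,3)] matrix_inv_mat2[OF det] tr by (simp add: A_def)
  \<comment> \<open>The inverse has the same trace, so the result for nonnegative powers applies to
    it.\<close>
  have "word_val S T (word_inv u) $ 1 $ 1 + word_val S T (word_inv u) $ 2 $ 2 = t"
    unfolding inv using tr by (simp add: A_def[symmetric] algebra_simps)
  from word_val_concat_replicate[OF det_word_val[OF assms(1,2)] this, of "nat (- n)"] False
  have *: "word_val S T (word_power n u) = (\<chi> i j. cheb (- n) t * (t * mat 1 $ i $ j - A $ i $ j) - cheb (- n - 1) t * mat 1 $ i $ j)"
    by (simp add: word_power_def inv)
  have "cheb (- n - 1) t = - cheb (n + 1) t" using cheb_minus[of "n + 1" t] by simp
  then show ?thesis unfolding * cheb_minus A_def[symmetric]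
    by (simp only: vec_eq_iff vec_lambda_beta cheb_rec) (simp add: algebra_simps)
qed

section \<open>Eigenvalue pairs and the Riley polynomial\<close>

context sl2_pair begin

lemma riley_eq: "riley n (h\<^sup>2 - 2) y = k * cheb n t - cheb (n - 1) t"
proof -
  have "h\<^sup>2 - 2 - 1 - y = X" by (simp add: X_def)
  then show ?thesis unfolding riley_def cheb_rec k_def by (simp only: t_def[symmetric]) (simp add: algebra_simps)
qed

lemma W_eq: "word_val S T (word_w n) = (\<chi> i j. cheb n t * U $ i $ j - cheb (n - 1) t * mat 1 $ i $ j)"
  unfolding word_w_eq by (rule word_val_word_power[OF detS detT _ trace_U]) (auto simp: word_u_def)

lemma rev_W_eq: "word_val S T (rev (word_w n)) = (\<chi> i j. cheb n t * U' $ i $ j - cheb (n - 1) t * mat 1 $ i $ j)"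
  unfolding word_w_eq rev_word_power by (rule word_val_word_power[OF detS detT _ trace_U']) (auto simp: word_u_def)

text \<open>\<open>W\<close> is a combination of \<open>U\<close> and \<open>1\<close>, and both
  contribute multiples of \<open>S - T\<close>, with factors \<open>k\<close> and
  \<open>1\<close>.\<close>

lemma SW_minus_WT:
  "S ** word_val S T (word_w n) - word_val S T (word_w n) ** T
    = (\<chi> i j. riley n (h\<^sup>2 - 2) y * (S $ i $ j - T $ i $ j))"
proof -
  have "S ** word_val S T (word_w n) - word_val S T (word_w n) ** T
    = (\<chi> i j. cheb n t * (S ** U - U ** T) $ i $ j - cheb (n - 1) t * (S $ i $ j - T $ i $ j))"
    unfolding W_eq by (simp add: mat2_eq_iff mat2_mult algebra_simps)
  then show ?thesis unfolding SU_minus_UT riley_eq by (simp add: vec_eq_iff algebra_simps)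
qed

lemma intertwines_iff_riley:
  assumes "S \<noteq> T"
  shows "S ** word_val S T (word_w n) = word_val S T (word_w n) ** T \<longleftrightarrow> riley n (h\<^sup>2 - 2) y = 0"
proof -
  have "S ** word_val S T (word_w n) = word_val S T (word_w n) ** T \<longleftrightarrow>
    S ** word_val S T (word_w n) - word_val S T (word_w n) ** T = 0" by simp
  also have "\<dots> \<longleftrightarrow> riley n (h\<^sup>2 - 2) y = 0"
    unfolding SW_minus_WT using assms by (auto simp: vec_eq_iff)
  finally show ?thesis .
qed

text \<open>Substituting \<open>cheb (n - 1) t = k * cheb n t\<close> into \<open>cheb_det\<close>
  determines the square of \<open>cheb n t\<close>, which removes it from the longitude
  eigenvalue.\<close>

lemma riley_root_cheb:
  assumes "riley n (h\<^sup>2 - 2) y = 0"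
  shows "(cheb n t)\<^sup>2 * (X\<^sup>2 * y * (y * (X + 1) - 1)) = 1"
proof -
  have "cheb (n - 1) t = k * cheb n t" using assms riley_eq[of n] by simp
  then have "(cheb n t)\<^sup>2 * (k\<^sup>2 + 1 - t * k) = 1"
    using cheb_det[of n t] by (simp add: power2_eq_square algebra_simps)
  moreover have "k\<^sup>2 + 1 - t * k = X\<^sup>2 * y * (y * (X + 1) - 1)"
    unfolding k_def t_def by algebra
  ultimately show ?thesis by simp
qed

lemma W_rev_W:
  assumes "riley n (h\<^sup>2 - 2) y = 0"
  shows "word_val S T (word_w n @ rev (word_w n)) =
    lincomb S T ((cheb n t)\<^sup>2 * n0) ((cheb n t)\<^sup>2 * n1) 0 0"
proof -
  have k: "cheb (n - 1) t = k * cheb n t" using assms riley_eq[of n] by simp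
  have "word_val S T (word_w n @ rev (word_w n)) =
    (\<chi> i j. (cheb n t)\<^sup>2 * (\<chi> i j. (U ** U')$i$j - k * (U$i$j + U'$i$j) + k^2 * mat 1 $ i $ j) $ i $ j)"
    unfolding word_val_append W_eq rev_W_eq k
    by (simp add: mat2_eq_iff mat2_mult power2_eq_square algebra_simps)
  then show ?thesis unfolding UU'_lincomb
    by (simp add: lincomb_def vec_eq_iff algebra_simps)
qed

end

section \<open>Relator, longitude and eigenvalues\<close>

lemma relator_iff:
  assumes "det S = 1" "det T = 1"
  shows "word_val S T (relator n) = mat 1 \<longleftrightarrow> S ** word_val S T (word_w n) = word_val S T (word_w n) ** T"
proof -
  define W where "W = word_val S T (word_w n)"
  have det: "det W = 1" by (simp add: W_def det_word_val assms)
  have inv: "word_val S T (word_inv (word_w n)) = matrix_inv W"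
    unfolding W_def
    by (intro word_val_word_inv assms) (auto simp: word_w_def word_inv_def word_u_def)
  have rel: "word_val S T (relator n) = S ** W ** matrix_inv T ** matrix_inv W"
    by (simp add: relator_def word_val_append inv W_def letter_val_def matrix_mul_assoc)
  have canc: "A ** matrix_inv B ** B = A" "A ** B ** matrix_inv B = A" if "det B = 1" for A B :: "complex^2^2"
    using mat2_mult_matrix_inv[OF that] by (simp_all flip: matrix_mul_assoc)
  show ?thesis unfolding rel W_def[symmetric]
    using canc[OF det] canc[OF assms(2)] by (metis matrix_mul_lid mat2_mult_matrix_inv(1) det)
qed

lemma word_spow_upper:
  assumes "det S = 1" "S $ 2 $ 1 = 0"
  shows "word_val S T (word_spow j) $ 2 $ 1 = 0" "word_val S T (word_spow j) $ 1 $ 1 = S $ 1 $ 1 powi j"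
proof -
  have S: "S $ 1 $ 1 * S $ 2 $ 2 = 1" using assms by (simp add: det_2)
  have rep: "word_val S T (replicate i a) $ 2 $ 1 = 0 \<and> word_val S T (replicate i a) $ 1 $ 1 = letter_val S T a $ 1 $ 1 ^ i"
    if "letter_val S T a $ 2 $ 1 = 0" for i a
    using that by (induction i) (auto simp: mat2_mult)
  have inv: "letter_val S T (-1) $ 2 $ 1 = 0" "letter_val S T (-1) $ 1 $ 1 = inverse (S $ 1 $ 1)"
    using assms S inverse_unique[OF S] by (auto simp: letter_val_def matrix_inv_mat2)
  have "letter_val S T 1 = S" by (simp add: letter_val_def)
  then show "word_val S T (word_spow j) $ 2 $ 1 = 0" "word_val S T (word_spow j) $ 1 $ 1 = S $ 1 $ 1 powi j"
    using rep[of 1] rep[of "-1"] inv assms by (auto simp: word_spow_def power_int_def)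
qed

lemma longitude_relation_identity:
  fixes M h :: complex
  assumes "M \<noteq> 0" "h = M + 1/M" "y = h\<^sup>2 - 3 - X"
  shows "(h\<^sup>2 * (X + 1)\<^sup>2 - (X + 2)\<^sup>2 - X * h * (X + 2) * M) * (M^2 * y - M^4)
    = (1/M^2 - y) * (y * (X + 1) - 1)"
proof -
  \<comment> \<open>Naming the inverse leaves a polynomial identity modulo
    \<open>M * i = 1\<close>.\<close>
  define i where "i = 1/M"
  have i: "M * i = 1" and h: "h = M + i" and i2: "1/M^2 = i^2" 
    using assms by (auto simp: i_def power_divide)
  show ?thesis unfolding i2 h assms(3) using i by algebra
qed

text \<open>By \<open>W_rev_W\<close> the product of \<open>W\<close> and its reverse is upper
  triangular along with \<open>S\<close>, and its eigenvalue is found by putting \<open>M\<close>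
  for \<open>S\<close>. The relation is kept free of denominators.\<close>

lemma (in sl2_pair) longitude_relation:
  assumes r: "riley n (h\<^sup>2 - 2) y = 0" and S: "S $ 2 $ 1 = 0" "S $ 1 $ 1 = M"
  shows "word_val S T (longitude n) $ 2 $ 1 = 0"
    and "word_val S T (longitude n) $ 1 $ 1 * M powi (4*n) * (M^2 * y - M^4) = 1/M^2 - y"
proof -
  have 1: "M * S $ 2 $ 2 = 1" using S detS by (simp add: det_2)
  then have M: "M \<noteq> 0" by auto
  with 1 have "S $ 2 $ 2 = 1/M" by (simp add: field_simps)
  with S trS have h: "h = M + 1/M" by simp
  have long: "word_val S T (longitude n) = lincomb S T ((cheb n t)\<^sup>2 * n0) ((cheb n t)\<^sup>2 * n1) 0 0
      ** word_val S T (word_spow (-4*n))"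
    using word_val_append[of S T "word_w n @ rev (word_w n)"] by (simp add: longitude_def W_rev_W[OF r])
  note spow = word_spow_upper[OF detS S(1), of T "-4*n"]
  show "word_val S T (longitude n) $ 2 $ 1 = 0"
    unfolding long mat2_mult spow by (simp add: S lincomb_def)
  have "word_val S T (longitude n) $ 1 $ 1 = (cheb n t)\<^sup>2 * (n0 + n1 * M) * M powi (-4*n)"
    unfolding long mat2_mult spow S by (simp add: S lincomb_def algebra_simps)
  then have L: "word_val S T (longitude n) $ 1 $ 1 * M powi (4*n) = (cheb n t)\<^sup>2 * (n0 + n1 * M)"
    using M by (simp add: power_int_minus)
  have "(cheb n t)\<^sup>2 * (n0 + n1 * M) * (M^2 * y - M^4) = (cheb n t)\<^sup>2 * (X\<^sup>2 * y) *
    ((h\<^sup>2 * (X + 1)\<^sup>2 - (X + 2)\<^sup>2 - X * h * (X + 2) * M) * (M^2 * y - M^4))"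
    unfolding n0_def n1_def by algebra
  also have "\<dots> = (cheb n t)\<^sup>2 * (X\<^sup>2 * y * (y * (X + 1) - 1)) * (1/M^2 - y)"
    by (subst longitude_relation_identity[OF M h]) (simp_all add: X_def)
  also have "\<dots> = 1/M^2 - y" by (simp add: riley_root_cheb[OF r])
  finally show "word_val S T (longitude n) $ 1 $ 1 * M powi (4*n) * (M^2 * y - M^4) = 1/M^2 - y"
    unfolding L .
qed

lemma eig_set_imp:
  assumes "(L, M) \<in> eig_set n"
  obtains y where "M \<noteq> 0" "riley n (M^2 + 1/M^2) y = 0"
    "L * M powi (4*n) * (M^2 * y - M^4) = 1/M^2 - y"
proof -
  from assms obtain S T where ST: "det S = 1" "det T = 1" "word_val S T (relator n) = mat 1"
      "S ** T \<noteq> T ** S" "S $ 2 $ 1 = 0" "S $ 1 $ 1 = M" 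
      "word_val S T (longitude n) $ 1 $ 1 = L"
    unfolding eig_set_def nonabelian_rep_def by auto
  have 1: "M * S $ 2 $ 2 = 1" using ST by (simp add: det_2)
  then have M: "M \<noteq> 0" by auto
  with 1 have S22: "S $ 2 $ 2 = 1/M" by (simp add: field_simps)
  have ne: "S \<noteq> T" using ST by auto
  define W where "W = word_val S T (word_w n)"
  have W: "det W = 1" by (simp add: W_def det_word_val ST)
  have eq: "S ** W = W ** T" using ST by (simp add: relator_iff W_def)
  then have T: "T = matrix_inv W ** S ** W"
    by (metis mat2_mult_matrix_inv(2)[OF W] matrix_mul_assoc matrix_mul_lid)
  \<comment> \<open>\<open>T\<close> is conjugate to \<open>S\<close> by \<open>W\<close>, which
    provides the common trace required by \<open>sl2_pair\<close>.\<close>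
  have "trace T = trace S" unfolding T
    by (metis trace_mul_sym matrix_mul_assoc mat2_mult_matrix_inv(1)[OF W] matrix_mul_lid)
  then have tr: "T $ 1 $ 1 + T $ 2 $ 2 = S $ 1 $ 1 + S $ 2 $ 2" by (simp add: trace_def sum_2)
  define h where "h = M + 1/M"
  define y where "y = (S ** T) $ 1 $ 1 + (S ** T) $ 2 $ 2 - 2"
  interpret sl2_pair S T h y
    by unfold_locales (use ST tr S22 in \<open>auto simp: h_def y_def\<close>)
  have x: "h\<^sup>2 - 2 = M^2 + 1/M^2" using M by (simp add: h_def power2_eq_square field_simps)
  have r: "riley n (h\<^sup>2 - 2) y = 0" using intertwines_iff_riley[OF ne] eq by (simp add: W_def)
  have "L * M powi (4*n) * (M^2 * y - M^4) = 1/M^2 - y"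
    using longitude_relation(2)[OF r ST(5,6)] ST(7) by simp
  with that M r show ?thesis unfolding x by blast
qed

lemma eig_set_intro:
  assumes M: "M \<noteq> 0" "M^2 \<noteq> 1" "y \<noteq> M^2" and r: "riley n (M^2 + 1/M^2) y = 0"
    and L: "L * M powi (4*n) * (M^2 * y - M^4) = 1/M^2 - y"
  shows "(L, M) \<in> eig_set n"
proof -
  define h where "h = M + 1/M"
  have x: "h\<^sup>2 - 2 = M^2 + 1/M^2" using M by (simp add: h_def power2_eq_square field_simps)
  \<comment> \<open>Riley's normal form; the lower left entry of \<open>T\<close> is the one that
    gives \<open>tr (ST) = y + 2\<close>.\<close>
  define S T :: "complex^2^2" where "S = vector [vector [M, 1], vector [0, 1/M]]"
    and "T = vector [vector [M, 0], vector [y + 4 - h\<^sup>2, 1/M]]"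
  have S: "S$1$1 = M" "S$1$2 = 1" "S$2$1 = 0" "S$2$2 = 1/M" by (auto simp: S_def)
  have T: "T$1$1 = M" "T$1$2 = 0" "T$2$1 = y + 4 - h\<^sup>2" "T$2$2 = 1/M" by (auto simp: T_def)
  interpret sl2_pair S T h y
    by unfold_locales (use M x in \<open>auto simp: det_2 S T mat2_mult h_def power2_eq_square field_simps\<close>)
  \<comment> \<open>The upper right entries of \<open>ST\<close> and \<open>TS\<close> are
    \<open>1/M\<close> and \<open>M\<close>, which differ even if \<open>T\<close> is
    diagonal.\<close>
  have nc: "S ** T \<noteq> T ** S"
    using M by (auto simp: mat2_eq_iff mat2_mult S T power2_eq_square field_simps)
  then have ne: "S \<noteq> T" by auto
  have r': "riley n (h\<^sup>2 - 2) y = 0" using r x by simp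
  have "nonabelian_rep n S T"
    unfolding nonabelian_rep_def relator_iff[OF detS detT] intertwines_iff_riley[OF ne]
    using r' nc detS detT by auto
  moreover note longitude_relation[OF r' S(3,1)]
  moreover have "word_val S T (longitude n) $ 1 $ 1 = L"
  proof -
    have "word_val S T (longitude n) $ 1 $ 1 * M powi (4*n) * (M^2 * y - M^4) = L * M powi (4*n) * (M^2 * y - M^4)"
      using longitude_relation(2)[OF r' S(3,1)] L by simp
    then have "(word_val S T (longitude n) $ 1 $ 1 - L) * (M powi (4*n) * M^2 * (y - M^2)) = 0"
      by algebra
    then show ?thesis using M by simp
  qed
  ultimately show ?thesis unfolding eig_set_def using S by blast
qed

section \<open>The formula as a value of the Riley polynomial\<close>

text \<open>Expansions of Chebyshev polynomials in \<open>v = t - 2\<close>. Pascal's rule gives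
  \<open>g (k+1) = g k + f k\<close> and \<open>f (k+1) = f k + v * g (k+1)\<close>, which the right
  sides satisfy as well.\<close>

lemma
  fixes v :: "'a::comm_ring_1"
  shows chain_sum_even: "(\<Sum>j\<le>k. of_nat ((k + j) choose (2*j)) * v ^ j) = cheb_nat (Suc k) (v + 2) - cheb_nat k (v + 2)"
    and chain_sum_odd: "(\<Sum>j<k. of_nat ((k + j) choose (2*j + 1)) * v ^ j) = cheb_nat k (v + 2)"
proof -
  define f where "f k = (\<Sum>j\<le>k. of_nat ((k + j) choose (2*j)) * v ^ j)" for k
  define g where "g k = (\<Sum>j<k. of_nat ((k + j) choose (2*j + 1)) * v ^ j)" for k
  have g: "g (Suc k) = g k + f k" for k
  proof -
    have "g (Suc k) = (\<Sum>j\<le>k. of_nat ((k + j) choose (2*j + 1)) * v ^ j + of_nat ((k + j) choose (2*j)) * v ^ j)"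
      unfolding g_def lessThan_Suc_atMost by (intro sum.cong) (auto simp: algebra_simps)
    also have "\<dots> = (\<Sum>j\<le>k. of_nat ((k + j) choose (2*j + 1)) * v ^ j) + f k"
      by (simp add: sum.distrib f_def)
    also have "(\<Sum>j\<le>k. of_nat ((k + j) choose (2*j + 1)) * v ^ j) = g k"
      by (simp add: g_def sum.lessThan_Suc binomial_eq_0 flip: lessThan_Suc_atMost)
    finally show ?thesis by simp
  qed
  have f: "f (Suc k) = f k + v * g (Suc k)" for k
  proof -
    have "f (Suc k) = 1 + (\<Sum>j<Suc k. of_nat ((Suc k + Suc j) choose (2 * Suc j)) * v ^ Suc j)"
      unfolding f_def by (subst sum.atMost_Suc_shift) (simp add: lessThan_Suc_atMost)
    also have "(\<Sum>j<Suc k. of_nat ((Suc k + Suc j) choose (2 * Suc j)) * v ^ Suc j)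
       = (\<Sum>j<Suc k. of_nat ((k + Suc j) choose (2 * Suc j)) * v ^ Suc j + v * (of_nat ((Suc k + j) choose (2*j + 1)) * v ^ j))"
      by (intro sum.cong) (auto simp: algebra_simps)
    also have "\<dots> = (\<Sum>j<Suc k. of_nat ((k + Suc j) choose (2 * Suc j)) * v ^ Suc j) + v * g (Suc k)"
      by (simp only: sum.distrib g_def sum_distrib_left)
    also have "1 + ((\<Sum>j<Suc k. of_nat ((k + Suc j) choose (2 * Suc j)) * v ^ Suc j) + v * g (Suc k)) = 
       (\<Sum>j\<le>Suc k. of_nat ((k + j) choose (2 * j)) * v ^ j) + v * g (Suc k)"
      by (subst sum.atMost_Suc_shift) (simp add: lessThan_Suc_atMost)
    also have "(\<Sum>j\<le>Suc k. of_nat ((k + j) choose (2 * j)) * v ^ j) = f k"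
      by (simp add: f_def binomial_eq_0)
    finally show ?thesis .
  qed
  have "f k = cheb_nat (Suc k) (v + 2) - cheb_nat k (v + 2) \<and> g k = cheb_nat k (v + 2)"
  proof (induction k)
    case 0
    then show ?case by (simp add: f_def g_def)
  next
    case (Suc k)
    then show ?case using f[of k] g[of k] by (simp add: algebra_simps)
  qed
  then show "(\<Sum>j\<le>k. of_nat ((k + j) choose (2*j)) * v ^ j) = cheb_nat (Suc k) (v + 2) - cheb_nat k (v + 2)"
    "(\<Sum>j<k. of_nat ((k + j) choose (2*j + 1)) * v ^ j) = cheb_nat k (v + 2)"
    by (simp_all add: f_def g_def)
qed

lemma sum_even_odd:
  fixes f :: "nat \<Rightarrow> 'a::comm_monoid_add"
  shows "(\<Sum>i<2*k. f i) = (\<Sum>j<k. f (2*j)) + (\<Sum>j<k. f (2*j + 1))"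
  by (induction k) (simp_all add: add_ac)

text \<open>With \<open>t = X^2 y + 2\<close>, the even indices add up to the difference of
  consecutive Chebyshev values and the odd ones to \<open>X y\<close> times a single one.\<close>

lemma riley_sum_nonneg:
  fixes x y :: "'a::comm_ring_1"
  shows "(\<Sum>i\<le>2*k. of_nat ((k + i div 2) choose i) * (x - 1 - y) ^ i * y ^ ((1 + i) div 2)) = riley (int k) x y"
proof -
  define X where "X = x - 1 - y"
  define c where "c i = of_nat ((k + i div 2) choose i) * X ^ i * y ^ ((1 + i) div 2)" for i
  have sq: "X ^ (2*j) = (X\<^sup>2) ^ j" "(- X) ^ (2*j) = (X\<^sup>2) ^ j" for j by (simp_all add: power_mult)
  have even: "c (2*j) = of_nat ((k + j) choose (2*j)) * (X\<^sup>2 * y) ^ j" for j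
    by (simp add: c_def sq power_mult_distrib)
  have odd: "c (2*j + 1) = X * y * (of_nat ((k + j) choose (2*j + 1)) * (X\<^sup>2 * y) ^ j)" for j
    by (simp add: c_def sq power_mult_distrib)
  have "(\<Sum>i\<le>2*k. c i) = (\<Sum>i<2*k. c i) + c (2*k)" by (simp flip: lessThan_Suc_atMost)
  also have "\<dots> = (\<Sum>j\<le>k. c (2*j)) + (\<Sum>j<k. c (2*j + 1))"
    unfolding sum_even_odd by (simp add: add_ac flip: lessThan_Suc_atMost)
  also have "\<dots> = cheb_nat (Suc k) (X\<^sup>2 * y + 2) - cheb_nat k (X\<^sup>2 * y + 2) + X * y * cheb_nat k (X\<^sup>2 * y + 2)"
    unfolding even odd sum_distrib_left[symmetric] chain_sum_even chain_sum_odd ..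
  also have "\<dots> = riley (int k) x y"
  proof -
    have "cheb (int k + 1) t = cheb_nat (Suc k) t" for t :: 'a
      using cheb_of_nat[of "Suc k" t] by (simp add: add.commute)
    then show ?thesis unfolding riley_def X_def[symmetric] by (simp only: cheb_of_nat)
  qed
  finally show ?thesis by (simp add: c_def X_def)
qed

lemma riley_sum_neg:
  fixes x y :: "'a::comm_ring_1"
  assumes "k > 0"
  shows "(\<Sum>i<2*k. of_nat (nat (int k + (int i - 1) div 2) choose i) * (- (x - 1 - y)) ^ i * y ^ ((1 + i) div 2)) = riley (- int k) x y"
proof -
  obtain l where l: "k = Suc l" using assms by (cases k) auto
  define X where "X = x - 1 - y"
  define c where "c i = of_nat (nat (int k + (int i - 1) div 2) choose i) * (- X) ^ i * y ^ ((1 + i) div 2)" for i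
  \<comment> \<open>\<open>div\<close> rounds down, so even indices belong to \<open>k - 1\<close>
    and odd ones to \<open>k\<close>; index 0 gives -1.\<close>
  have div: "(2 * int j - 1) div 2 = int j - 1" for j by linarith
  have n: "nat (int l + int j) = l + j" "nat (1 + (int j + int l)) = Suc (l + j)" for j by auto
  have sq: "X ^ (2*j) = (X\<^sup>2) ^ j" "(- X) ^ (2*j) = (X\<^sup>2) ^ j" for j by (simp_all add: power_mult)
  have even: "c (2*j) = of_nat ((l + j) choose (2*j)) * (X\<^sup>2 * y) ^ j" for j
    by (simp add: c_def l n div sq power_mult_distrib)
  have odd: "c (2*j + 1) = - X * y * (of_nat ((k + j) choose (2*j + 1)) * (X\<^sup>2 * y) ^ j)" for j
    by (simp add: c_def l n sq power_mult_distrib add_ac)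
  have "(\<Sum>i<2*k. c i) = (\<Sum>j\<le>l. c (2*j)) + (\<Sum>j<k. c (2*j + 1))"
    unfolding sum_even_odd unfolding l lessThan_Suc_atMost ..
  also have "\<dots> = cheb_nat k (X\<^sup>2 * y + 2) - cheb_nat l (X\<^sup>2 * y + 2) - X * y * cheb_nat k (X\<^sup>2 * y + 2)"
    unfolding even odd sum_distrib_left[symmetric] chain_sum_even chain_sum_odd by (simp add: l)
  also have "\<dots> = riley (- int k) x y"
  proof -
    have "- int k + 1 = - int l" by (simp add: l)
    then show ?thesis unfolding riley_def X_def[symmetric] by (simp add: cheb_minus cheb_of_nat)
  qed
  finally show ?thesis by (simp add: c_def X_def)
qed

text \<open>The degree of the Riley polynomial in \<open>y\<close>, serving as degree bound in
  \<open>L\<close>.\<close>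

definition riley_degree :: "int \<Rightarrow> nat" where
  "riley_degree n = nat (if n \<ge> 0 then 3*n else -3*n - 1)"

text \<open>For negative \<open>n\<close> this is \<open>8n + 6\<close> plus the exponent
  \<open>-4n (-3n - 1)\<close> extracted from the last factor of the formula.\<close>

definition prefactor_exp :: "int \<Rightarrow> int" where
  "prefactor_exp n = (if n \<ge> 0 then -2*n else 12*n^2 + 12*n + 6)"

text \<open>The coordinate \<open>y\<close> recovered from the eigenvalues, with \<open>l = L M\<^bsup>4n\<^esup>\<close>.\<close>
definition riley_root :: "complex \<Rightarrow> complex \<Rightarrow> complex" where
  "riley_root l M = (1 + l * M^6) / (M^2 * (1 + l * M^2))"

lemma riley_root_X:
  assumes "M \<noteq> 0" "1 + l * M^2 \<noteq> 0"
  shows "M^2 + 1/M^2 - 1 - riley_root l M = (l - 1) * (1 - M^2) / (1 + l * M^2)"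
proof -
  define i where "i = 1/M^2"
  have i: "M^2 * i = 1" using assms by (simp add: i_def)
  have "riley_root l M * (1 + l * M^2) = (1 + l * M^6) * i"
    using assms by (simp add: riley_root_def i_def)
  with i have "(M^2 + i - 1 - riley_root l M) * (1 + l * M^2) = (l - 1) * (1 - M^2)" by algebra
  then show ?thesis using assms by (simp add: i_def eq_divide_eq)
qed

text \<open>With \<open>y = riley_root l M\<close>, the two quotients in the formula are
  \<open>x - 1 - y\<close>, negated for \<open>n < 0\<close>, and \<open>y\<close>; the sum is then
  a Riley polynomial.\<close>

lemma A_formula_eq_riley:
  assumes M: "M \<noteq> 0" and D: "1 + L * M powi (4*n) * M^2 \<noteq> 0"
  shows "A_formula n L M = M powi prefactor_exp n * (1 + L * M powi (4*n) * M^2) ^ riley_degree n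
    * riley n (M^2 + 1/M^2) (riley_root (L * M powi (4*n)) M)"
proof -
  define l where "l = L * M powi (4*n)"
  have D': "1 + l * M^2 \<noteq> 0" using D by (simp add: l_def)
  define y where "y = riley_root l M"
  define x where "x = M^2 + 1/M^2"
  have X: "x - 1 - y = (l - 1) * (1 - M^2) / (1 + l * M^2)"
    unfolding x_def y_def by (rule riley_root_X[OF M D'])
  have p: "M powi (i + 4*n) = M ^ nat i * M powi (4*n)" if "i \<ge> 0" for i
    using M that power_int_add[of M i "4*n"] by (simp add: power_int_def[of M i])
  show ?thesis
  proof (cases "n \<ge> 0")
    case True
    have "A_formula n L M = (\<Sum>i\<le>2*nat n. of_nat ((nat n + i div 2) choose i) * (x - 1 - y) ^ i * y ^ ((1 + i) div 2)
       * (M powi (-2*n) * (1 + l * M^2) powi (3*n)))"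
    proof -
      have e: "1 + L * M powi (2 + 4*n) = 1 + l * M^2" "1 + L * M powi (6 + 4*n) = 1 + l * M^6"
         "M^2 + L * M powi (4 + 4*n) = M^2 * (1 + l * M^2)"
        by (simp_all add: p l_def) algebra
      have "nat (2*n) = 2 * nat n" using True by auto
      then show ?thesis using True unfolding A_formula_def e l_def[symmetric] X by (simp add: y_def riley_root_def atLeast0AtMost mult_ac)
    qed
    also have "\<dots> = riley n x y * (M powi (-2*n) * (1 + l * M^2) powi (3*n))"
      using True riley_sum_nonneg[where k = "nat n" and x = x and y = y] by (simp flip: sum_distrib_right)
    also have "(1 + l * M^2) powi (3*n) = (1 + l * M^2) ^ riley_degree n"
      using True by (simp add: riley_degree_def power_int_def)
    finally show ?thesis using True by (simp add: prefactor_exp_def l_def x_def y_def mult_ac)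
  next
    case False
    define k where "k = nat (- n)"
    have k: "k > 0" "n = - int k" using False by (auto simp: k_def)
    \<comment> \<open>For negative \<open>n\<close> all numerators and denominators share the factor
      \<open>E\<close>, whose removal turns \<open>L\<close> into \<open>l\<close>.\<close>
    define E where "E = M powi (-4*n)"
    have E: "E \<noteq> 0" "L = l * E" using M by (auto simp: E_def l_def power_int_minus)
    have e: "L * M^2 + E = E * (1 + l * M^2)" "L * M^6 + E = E * (1 + l * M^6)" "E - L = - (E * (l - 1))"
       by (simp_all add: E algebra_simps)
    have e4: "L * M^4 + M powi (2 - 4*n) = E * (M^2 * (1 + l * M^2))" 
      using M by (simp add: E_def[unfolded power_int_minus] E power_int_diff power_int_minus field_simps)
    have "A_formula n L M = (\<Sum>i<2*k. of_nat (nat (int k + (int i - 1) div 2) choose i) * (- (x - 1 - y)) ^ i * y ^ ((1 + i) div 2)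
       * (M powi (8*n + 6) * (E * (1 + l * M^2)) powi (-3*n - 1)))"
    proof -
      have s: "{0..nat (-2*n - 1)} = {..<2*k}" using k by auto
      have "(1 - M^2) * - (E * (l - 1)) = E * - ((l - 1) * (1 - M^2))" by algebra
      then have 1: "(1 - M^2) * - (E * (l - 1)) / (E * (1 + l * M^2)) = - (x - 1 - y)"
        unfolding X using E by simp
      have 2: "E * (1 + l * M^6) / (E * (M^2 * (1 + l * M^2))) = y"
        using E by (simp add: y_def riley_root_def)
      show ?thesis using False unfolding A_formula_def E_def[symmetric] e e4 s 1 2 by (simp add: k(2) mult_ac)
    qed
    also have "\<dots> = riley n x y * (M powi (8*n + 6) * (E * (1 + l * M^2)) powi (-3*n - 1))"
      using k(2) riley_sum_neg[OF k(1), where x = x and y = y] by (simp flip: sum_distrib_right)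
    also have "(E * (1 + l * M^2)) powi (-3*n - 1) = M powi (-4*n * (-3*n - 1)) * (1 + l * M^2) ^ riley_degree n"
    proof -
      have "E powi (-3*n - 1) = M powi (-4*n * (-3*n - 1))" unfolding E_def by (rule power_int_mult[symmetric])
      then show ?thesis
        using False by (simp add: riley_degree_def power_int_def[of "1 + l * M^2"] power_int_mult_distrib)
    qed
    also have "M powi (8*n + 6) * (M powi (-4*n * (-3*n - 1)) * (1 + l * M^2) ^ riley_degree n)
       = M powi prefactor_exp n * (1 + l * M^2) ^ riley_degree n"
    proof -
      have "prefactor_exp n = 8*n + 6 + (-4*n * (-3*n - 1))"
        using False by (simp add: prefactor_exp_def power2_eq_square algebra_simps)
      then have "M powi prefactor_exp n = M powi (8*n + 6) * M powi (-4*n * (-3*n - 1))"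
        using power_int_add[of M "8*n + 6" "-4*n * (-3*n - 1)"] M by simp
      then show ?thesis by simp
    qed
    finally show ?thesis by (simp add: l_def x_def y_def mult_ac)
  qed
qed

lemma formula_defined_iff:
  "formula_defined n L M \<longleftrightarrow> M \<noteq> 0 \<and> 1 + L * M powi (4*n) * M^2 \<noteq> 0"
proof (cases "M = 0")
  case False
  define l where "l = L * M powi (4*n)"
  have p: "M powi (i + 4*n) = M ^ nat i * M powi (4*n)" if "i \<ge> 0" for i
    using False that power_int_add[of M i "4*n"] by (simp add: power_int_def[of M i])
  have e: "1 + L * M powi (2 + 4*n) = 1 + l * M^2" "M^2 + L * M powi (4 + 4*n) = M^2 * (1 + l * M^2)"
    by (simp_all add: p l_def) algebra
  define E where "E = M powi (-4*n)"
  have E: "E \<noteq> 0" "L = l * E" using False by (auto simp: E_def l_def power_int_minus)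
  have e': "L * M^2 + E = E * (1 + l * M^2)" by (simp add: E algebra_simps)
  have e4: "L * M^4 + M powi (2 - 4*n) = E * (M^2 * (1 + l * M^2))" 
    using False by (simp add: E_def[unfolded power_int_minus] E power_int_diff power_int_minus field_simps)
  show ?thesis
    unfolding formula_defined_def E_def[symmetric] e e' e4 l_def[symmetric] using False E by auto
qed (simp add: formula_defined_def)

section \<open>Real roots near the dihedral point\<close>

lemma riley_rec: "riley (n + 1) x y = ((x - 1 - y)^2 * y + 2) * riley n x y - riley (n - 1) x y"
proof -
  define t where "t = (x - 1 - y)^2 * y + 2"
  have "cheb (n + 1 + 1) t = t * cheb (n + 1) t - cheb n t" "cheb (n + 1) t = t * cheb n t - cheb (n - 1) t"
    "cheb (n - 1 + 1) t = cheb n t"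
    using cheb_rec[of "n + 1" t] cheb_rec[of n t] by simp_all
  then show ?thesis unfolding riley_def t_def[symmetric] by (simp only:) (simp add: algebra_simps)
qed

text \<open>At the dihedral representations (\<open>M\<^sup>2 = -1\<close>) the Riley polynomial is explicit and visibly
  has only simple roots.\<close>
lemma riley_dihedral:
  fixes p :: real
  shows "riley n (-2) (2 * cos (2*p) - 2) * cos p = cos ((6 * of_int n + 1) * p)"
proof -
  define u where "u = cos p"
  define y where "y = 2 * cos (2*p) - 2"
  have r: "cos ((a + 1) * p) = 2 * u * cos (a * p) - cos ((a - 1) * p)" for a
    by (simp add: u_def algebra_simps cos_add cos_diff)
  have c1: "cos (1*p) = u" by (simp add: u_def)
  have c2: "cos (2*p) = 2*u^2 - 1" using r[of 1] c1 by (simp add: power2_eq_square)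
  have c3: "cos (3*p) = 4*u^3 - 3*u"
  proof -
    have "cos (3*p) = 2 * u * (2*u^2 - 1) - u" using r[of 2] c2 c1 by simp
    also have "\<dots> = 4*u^3 - 3*u" by algebra
    finally show ?thesis .
  qed
  have c4: "cos (4*p) = 8*u^4 - 8*u^2 + 1"
  proof -
    have "cos (4*p) = 2 * u * (4*u^3 - 3*u) - (2*u^2 - 1)" using r[of 3] c2 c3 by simp
    also have "\<dots> = 8*u^4 - 8*u^2 + 1" by algebra
    finally show ?thesis .
  qed
  have c5: "cos (5*p) = 16*u^5 - 20*u^3 + 5*u"
  proof -
    have "cos (5*p) = 2 * u * (8*u^4 - 8*u^2 + 1) - (4*u^3 - 3*u)" using r[of 4] c4 c3 by simp
    also have "\<dots> = 16*u^5 - 20*u^3 + 5*u" by algebra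
    finally show ?thesis .
  qed
  have c6: "cos (6*p) = 32*u^6 - 48*u^4 + 18*u^2 - 1"
  proof -
    have "cos (6*p) = 2 * u * (16*u^5 - 20*u^3 + 5*u) - (8*u^4 - 8*u^2 + 1)" using r[of 5] c5 c4 by simp
    also have "\<dots> = 32*u^6 - 48*u^4 + 18*u^2 - 1" by algebra
    finally show ?thesis .
  qed
  have c7: "cos (7*p) = 64*u^7 - 112*u^5 + 56*u^3 - 7*u"
  proof -
    have "cos (7*p) = 2 * u * (32*u^6 - 48*u^4 + 18*u^2 - 1) - (16*u^5 - 20*u^3 + 5*u)" using r[of 6] c6 c5 by simp
    also have "\<dots> = 64*u^7 - 112*u^5 + 56*u^3 - 7*u" by algebra
    finally show ?thesis .
  qed
  have y: "y = 4*u^2 - 4" by (simp add: y_def c2)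
  define e where "e n = cos ((6 * of_int n + 1) * p)" for n :: int
  \<comment> \<open>Here \<open>t = 2 cos (6p)\<close>, so both sides of the claim obey one
    second-order recurrence in \<open>n\<close>, and agreement at 0 and 1 suffices.\<close>
  have e_rec: "e (n + 1) = ((-2 - 1 - y)^2 * y + 2) * e n - e (n - 1)" for n
  proof -
    have "e (n + 1) + e (n - 1) = 2 * cos (6*p) * e n"
    proof -
      have "(6 * of_int (n + 1) + 1) * p = (6 * of_int n + 1) * p + 6*p" 
        "(6 * of_int (n - 1) + 1) * p = (6 * of_int n + 1) * p - 6*p" by (auto simp: algebra_simps)
      then show ?thesis unfolding e_def by (simp add: cos_add cos_diff)
    qed
    moreover have "2 * cos (6*p) = (-2 - 1 - y)^2 * y + 2" unfolding y c6 by algebra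
    ultimately show ?thesis by (simp add: algebra_simps)
  qed
  have rel: "riley (n + 1 + 1) (-2) y * u
      = ((-2 - 1 - y)^2 * y + 2) * (riley (n + 1) (-2) y * u) - riley n (-2) y * u" for n
    unfolding riley_rec[of "n + 1"] add_diff_cancel_right' by (simp only: left_diff_distrib mult.assoc)
  have "riley n (-2) y * u = e n \<and> riley (n + 1) (-2) y * u = e (n + 1)"
  proof (induction n rule: int_bidir_induct)
    case base
    have "riley 0 (-2) y * u = e 0" by (simp add: riley_def e_def u_def)
    moreover have "riley 1 (-2) y * u = e 1"
    proof -
      have "riley 1 (-2) y = ((-2 - 1 - y)^2 * y + 2) - 1 + (-2 - 1 - y) * y"
        using cheb_rec[of 1 "(-2 - 1 - y)^2 * y + 2"] by (simp add: riley_def)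
      also have "\<dots> * u = 64*u^7 - 112*u^5 + 56*u^3 - 7*u" unfolding y by algebra
      also have "\<dots> = e 1" using c7 by (simp add: e_def)
      finally show ?thesis .
    qed
    ultimately show ?case by simp
  next
    case (step n)
    then show ?case using rel[of n] e_rec[of "n + 1"] by simp
  next
    case (pred n)
    then show ?case using rel[of n] e_rec[of "n + 1"] by simp
  qed
  then show ?thesis by (simp add: y_def u_def e_def)
qed

lemma continuous_on_cheb [continuous_intros]:
  fixes f :: "'a::topological_space \<Rightarrow> real"
  assumes "continuous_on A f"
  shows "continuous_on A (\<lambda>z. cheb n (f z))"
proof -
  have "continuous_on A (\<lambda>z. cheb_nat k (f z))" for k
  proof (induction k rule: induct_nat_012)
    case (ge2 k)
    then show ?case by (auto intro!: continuous_intros assms)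
  qed auto
  then show ?thesis by (cases "n \<ge> 0") (auto simp: cheb_def intro!: continuous_intros)
qed

lemma continuous_on_riley [continuous_intros]:
  fixes f g :: "'a::topological_space \<Rightarrow> real"
  assumes "continuous_on A f" "continuous_on A g"
  shows "continuous_on A (\<lambda>z. riley n (f z) (g z))"
  unfolding riley_def by (intro continuous_intros assms)

text \<open>The intermediate value theorem gives a root between consecutive points; the ordering of
  the points makes these roots distinct.\<close>

lemma alternating_signs_roots:
  fixes g :: "real \<Rightarrow> real" and y :: "nat \<Rightarrow> real"
  assumes cont: "continuous_on UNIV g"
    and dec: "\<And>i j. i < j \<Longrightarrow> j \<le> d \<Longrightarrow> y j < y i"
    and alt: "\<And>j. j \<le> d \<Longrightarrow> (-1) ^ j * g (y j) > 0"
  shows "\<exists>R. finite R \<and> card R = d \<and> (\<forall>z\<in>R. g z = 0)"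
proof -
  have "\<exists>z. y (Suc j) < z \<and> z < y j \<and> g z = 0" if "j < d" for j
  proof -
    have "\<exists>z\<ge>y (Suc j). z \<le> y j \<and> (-1) ^ j * g z = 0"
      using alt[of j] alt[of "Suc j"] that dec[of j "Suc j"]
      by (intro IVT' continuous_intros continuous_on_subset[OF cont]) auto
    then obtain z where z: "y (Suc j) \<le> z" "z \<le> y j" "g z = 0" by auto
    moreover have "z \<noteq> y j" "z \<noteq> y (Suc j)" using alt[of j] alt[of "Suc j"] that z by auto
    ultimately show ?thesis by (intro exI[of _ z]) auto
  qed
  then obtain z where z: "\<And>j. j < d \<Longrightarrow> y (Suc j) < z j \<and> z j < y j \<and> g (z j) = 0" by metis
  have "z j < z i" if "i < j" "j < d" for i j
  proof -
    have "y j \<le> y (Suc i)" using dec[of "Suc i" j] that by (cases "j = Suc i") auto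
    then show ?thesis using z[of i] z[of j] that by auto
  qed
  then have "inj_on z {..<d}" by (intro linorder_inj_onI') force+
  then show ?thesis using z by (intro exI[of _ "z ` {..<d}"]) (auto simp: card_image)
qed

lemma riley_roots_near_dihedral:
  "eventually (\<lambda>x::real. \<exists>R. finite R \<and> card R = riley_degree n \<and> (\<forall>y\<in>R. riley n x y = 0)) (at (-2))"
proof -
  define d where "d = riley_degree n"
  \<comment> \<open>\<open>N\<close> equals the absolute value of \<open>6n + 1\<close>, so at the
    angles \<open>p j\<close> the cosine in \<open>riley_dihedral\<close> is
    \<open>(-1)^j\<close>.\<close>
  define N where "N = real (2*d + 1)"
  define p where "p j = pi * real j / N" for j
  define y where "y j = 2 * cos (2 * p j) - 2" for j
  have N: "N = \<bar>6 * of_int n + 1\<bar>" "N > 0"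
    by (auto simp: N_def d_def riley_degree_def)
  have p: "0 \<le> p j" "p j < pi/2" if "j \<le> d" for j
  proof -
    have "real j * 2 < N" using that by (simp add: N_def)
    then have "pi * (real j * 2) < pi * N" by simp
    then show "0 \<le> p j" "p j < pi/2" using N(2) by (simp_all add: p_def field_simps)
  qed
  have dec: "y j < y i" if "i < j" "j \<le> d" for i j
  proof -
    have "p i < p j" using that N(2) by (simp add: p_def field_simps)
    then show ?thesis using p[of i] p[of j] that by (simp add: y_def cos_monotone_0_pi)
  qed
  have alt: "(-1) ^ j * riley n (-2) (y j) > 0" if "j \<le> d" for j
  proof -
    have c: "cos (p j) > 0" using p[OF that] by (intro cos_gt_zero_pi) auto
    have "cos ((6 * of_int n + 1) * p j) = cos (N * p j)"
    proof (cases "6 * n + 1 \<ge> 0")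
      case False
      then have "N = - (6 * of_int n + 1)" unfolding N(1) by linarith
      then show ?thesis by (simp only: mult_minus_left cos_minus)
    qed (use N(1) in simp)
    also have "N * p j = pi * real j" using N by (simp add: p_def)
    finally have "riley n (-2) (y j) * cos (p j) = (-1) ^ j"
      using riley_dihedral[of n "p j"] by (simp add: y_def cos_npi2)
    then have "(-1) ^ j * riley n (-2) (y j) * cos (p j) = 1"
      by (simp add: mult.assoc)
    then show ?thesis using c by (metis zero_less_mult_pos2 zero_less_one)
  qed
  \<comment> \<open>Finitely many strict inequalities persist for nearby \<open>x\<close> by
    continuity.\<close>
  have "eventually (\<lambda>x. \<forall>j\<in>{..d}. (-1) ^ j * riley n x (y j) > 0) (at (-2))"
  proof (intro eventually_ball_finite ballI)
    fix j assume j: "j \<in> {..d}"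
    have "continuous_on UNIV (\<lambda>x. (-1) ^ j * riley n x (y j))" by (intro continuous_intros)
    then have "((\<lambda>x. (-1) ^ j * riley n x (y j)) \<longlongrightarrow> (-1) ^ j * riley n (-2) (y j)) (at (-2))"
      by (simp add: continuous_on_def)
    then show "eventually (\<lambda>x. (-1) ^ j * riley n x (y j) > 0) (at (-2))"
      using alt[of j] j by (intro order_tendstoD(1)) auto
  qed simp
  then show ?thesis
  proof eventually_elim
    case (elim x)
    have "continuous_on UNIV (riley n x)" by (intro continuous_intros)
    then show ?case unfolding d_def[symmetric]
      by (rule alternating_signs_roots[where y = y]) (use dec elim in auto)
  qed
qed

lemma of_real_riley: "riley n (of_real x) (of_real y) = (of_real (riley n x y) :: complex)"
proof -
  have n: "cheb_nat k (of_real t) = (of_real (cheb_nat k t) :: complex)" for k t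
    by (induction k rule: induct_nat_012) simp_all
  have "cheb n (of_real t) = (of_real (cheb n t) :: complex)" for n t
    by (simp add: cheb_def n)
  from this[of _ "(x - 1 - y)^2 * y + 2"] show ?thesis
    by (simp add: riley_def)
qed

text \<open>Each real \<open>x\<close> slightly above -2 has the form \<open>M^2 + 1/M^2\<close>,
  and \<open>M^4 = 1\<close> would force \<open>x = 2\<close> or \<open>x = -2\<close>. Infinitely
  many \<open>x\<close> need infinitely many \<open>M\<close>.\<close>

lemma infinite_generic_M:
  "infinite {M::complex. M \<noteq> 0 \<and> M^4 \<noteq> 1 \<and>
    (\<exists>R. finite R \<and> card R = riley_degree n \<and> (\<forall>y\<in>R. riley n (M^2 + 1/M^2) y = 0))}" (is "infinite ?A")
proof
  assume fin: "finite ?A"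
  define Q where "Q x \<longleftrightarrow> (\<exists>R. finite R \<and> card R = riley_degree n \<and> (\<forall>y\<in>R. riley n x y = 0))" for x :: real
  have "eventually Q (at (-2))" using riley_roots_near_dihedral[of n] unfolding Q_def[abs_def] .
  then obtain e where e: "e > 0" and Q: "\<And>x. x \<noteq> -2 \<Longrightarrow> dist x (-2) < e \<Longrightarrow> Q x"
    unfolding eventually_at by blast
  define I where "I = {-2<..<-2 + min e 1}"
  have "complex_of_real ` I \<subseteq> (\<lambda>M. M^2 + 1/M^2) ` ?A"
  proof
    fix z assume "z \<in> complex_of_real ` I"
    then obtain x where x: "z = of_real x" "-2 < x" "x < -2 + e" "x < -1" by (auto simp: I_def)
    define m where "m = (z + csqrt (z^2 - 4)) / 2"
    have "2 * m - z = csqrt (z^2 - 4)" by (simp add: m_def field_simps)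
    then have "(2 * m - z)^2 = z^2 - 4" by simp
    then have m: "m^2 + 1 = z * m" by algebra
    then have m0: "m \<noteq> 0" by auto
    define M where "M = csqrt m"
    have M: "M^2 = m" by (simp add: M_def)
    have "m + 1/m = (m^2 + 1) / m" using m0 by (simp add: power2_eq_square add_divide_distrib)
    then have z: "M^2 + 1/M^2 = z" unfolding M m using m0 by simp
    have "M^4 \<noteq> 1"
    proof
      assume "M^4 = 1"
      then have "m^2 = 1" unfolding M[symmetric] by (simp flip: power_mult)
      with m have "z = 2 * m" by algebra
      moreover from \<open>m^2 = 1\<close> have "m = 1 \<or> m = -1" by (simp add: power2_eq_1_iff)
      ultimately have "z = 2 \<or> z = -2" by auto
      then have "x = 2 \<or> x = -2" unfolding x by (metis of_real_eq_iff of_real_minus of_real_numeral)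
      then show False using x by auto
    qed
    moreover obtain R where R: "finite R" "card R = riley_degree n" "\<forall>y\<in>R. riley n x y = 0"
      using Q[of x] x by (auto simp: dist_real_def Q_def)
    then have "finite (complex_of_real ` R)" "card (complex_of_real ` R) = riley_degree n"
      "\<forall>y\<in>complex_of_real ` R. riley n (M^2 + 1/M^2) y = 0"
      unfolding z x(1) by (auto simp: card_image inj_on_def of_real_riley)
    moreover have "M \<noteq> 0" using M m0 by auto
    ultimately have "M \<in> ?A" by blast
    from imageI[OF this, of "\<lambda>M. M^2 + 1/M^2"] z show "z \<in> (\<lambda>M. M^2 + 1/M^2) ` ?A" by simp
  qed
  then have "finite (complex_of_real ` I)" using fin finite_surj by blast
  then have "finite I" by (rule finite_imageD) (auto simp: inj_on_def)
  then show False using e infinite_Ioo[of "-2" "-2 + min e 1"] by (simp add: I_def)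
qed

section \<open>Divisibility of bivariate polynomials\<close>

text \<open>Specializes the inner variable; after the variables are swapped, this fixes
  \<open>M\<close> and leaves a polynomial in \<open>L\<close>.\<close>

definition poly_at :: "'a::comm_ring_1 poly poly \<Rightarrow> 'a \<Rightarrow> 'a poly" where
  "poly_at p a = map_poly (\<lambda>c. poly c a) p"

lemma coeff_poly_at: "coeff (poly_at p a) i = poly (coeff p i) a"
  by (simp add: poly_at_def coeff_map_poly)

lemma degree_poly_at_le: "degree (poly_at p a) \<le> degree p"
  by (intro degree_le) (simp add: coeff_poly_at coeff_eq_0)

lemma poly_poly_at: "poly (poly_at p a) x = beval p a x"
  unfolding poly_at_def beval_def
  by (induction p) (simp_all add: map_poly_pCons)

lemma beval_eq_sum:
  assumes "degree p \<le> d"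
  shows "beval p M z = (\<Sum>j\<le>d. poly (coeff p j) M * z ^ j)"
proof -
  have "poly_at p M = (\<Sum>j\<le>d. monom (coeff (poly_at p M) j) j)"
    by (rule poly_as_sum_of_monoms'[symmetric]) (use degree_poly_at_le assms order_trans in blast)
  then have "poly (poly_at p M) z = poly (\<Sum>j\<le>d. monom (coeff (poly_at p M) j) j) z" by simp
  then show ?thesis by (simp add: poly_poly_at poly_sum poly_monom coeff_poly_at)
qed

lemma beval_simps [simp]:
  "beval 0 L M = 0" "beval 1 L M = 1"
  "beval (p + q) L M = beval p L M + beval q L M"
  "beval (p - q) L M = beval p L M - beval q L M"
  "beval (p * q) L M = beval p L M * beval q L M"
  "beval (smult c p) L M = poly c L * beval p L M"
  "beval (p ^ k) L M = beval p L M ^ k"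
  "beval (pCons c p) L M = poly c L + M * beval p L M"
  by (simp_all add: beval_def)

lemma poly_eq_0_if_poly_at_eq_0:
  fixes p :: "complex poly poly"
  assumes "infinite A" "\<And>a. a \<in> A \<Longrightarrow> poly_at p a = 0"
  shows "p = 0"
proof (rule poly_eqI)
  fix i
  have "A \<subseteq> {a. poly (coeff p i) a = 0}" using assms(2) by (auto simp flip: coeff_poly_at)
  then have "infinite {a. poly (coeff p i) a = 0}" using assms(1) finite_subset by blast
  then show "coeff p i = coeff 0 i" using poly_roots_finite by auto
qed

lemma poly_at_eqI:
  fixes p q :: "complex poly poly"
  assumes "\<And>x. beval p a x = beval q a x"
  shows "poly_at p a = poly_at q a"
  by (intro poly_ext) (simp add: poly_poly_at assms)

lemma beval_eqI:
  assumes "\<And>L M. beval p L M = beval q L M"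
  shows "p = q"
proof -
  have "poly_at (p - q) a = poly_at 0 a" for a by (rule poly_at_eqI) (simp add: assms)
  then have "p - q = 0"
    by (intro poly_eq_0_if_poly_at_eq_0[of UNIV]) (simp_all add: infinite_UNIV_char_0 poly_at_def)
  then show ?thesis by simp
qed

text \<open>Division with respect to \<open>L\<close> needs \<open>L\<close> as outer variable,
  whereas the theorem has \<open>M\<close> outside.\<close>

lemma ex_swapped_poly: "\<exists>q. \<forall>L M. beval q L M = beval p M L"
proof (induction p)
  case 0
  then show ?case by (intro exI[of _ 0]) simp
next
  case (pCons c p)
  then obtain q where q: "\<And>L M. beval q L M = beval p M L" by blast
  have "beval (map_poly (\<lambda>a. [:a:]) c) L M = poly c M" for L M
    by (induction c) (simp_all add: map_poly_pCons)
  then show ?case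
    by (intro exI[of _ "map_poly (\<lambda>a. [:a:]) c + smult [:0, 1:] q"]) (simp add: q)
qed

text \<open>A factor \<open>c(M)\<close> is cancelled one root at a time: \<open>p\<close> does not vanish identically
  on the line \<open>M = a\<close>, so the cofactor \<open>s\<close> does.\<close>
lemma dvd_if_dvd_smult:
  fixes p q s :: "complex poly poly"
  assumes "c \<noteq> 0" "smult c q = p * s" and p: "\<And>a. poly_at p a \<noteq> 0"
  shows "p dvd q"
  using assms(1,2)
proof (induction "degree c" arbitrary: c s)
  case 0
  then obtain b where b: "c = [:b:]" "b \<noteq> 0" by (metis degree_eq_zeroE pCons_0_0)
  have "q = smult [:1/b:] (smult c q)" using b by (simp add: one_pCons[symmetric])
  also have "\<dots> = p * smult [:1/b:] s" using 0 by (simp only: mult_smult_right)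
  finally show ?case by (rule dvdI)
next
  case (Suc k)
  then have "\<not> constant (poly c)" by (simp add: constant_degree)
  then obtain a where a: "poly c a = 0" using fundamental_theorem_of_algebra by blast
  then obtain c' where c': "c = [:- a, 1:] * c'" by (metis dvdE poly_eq_0_iff_dvd)
  have c'0: "c' \<noteq> 0" using Suc.prems c' by auto
  then have deg: "k = degree c'" using Suc.hyps(2) unfolding c' by (subst (asm) degree_mult_eq) auto
  have "poly_at p a * poly_at s a = 0"
  proof (rule poly_ext)
    fix x
    have "beval p a x * beval s a x = beval (smult c q) a x" by (simp add: Suc.prems(2))
    then show "poly (poly_at p a * poly_at s a) x = poly 0 x" by (simp add: poly_poly_at a)
  qed
  then have "poly_at s a = 0" using p by simp
  then have "[:- a, 1:] dvd coeff s i" for i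
    by (metis coeff_poly_at coeff_0 poly_eq_0_iff_dvd)
  then have "[:[:- a, 1:]:] dvd s" by (simp add: const_poly_dvd_iff)
  then obtain s' where s': "s = smult [:- a, 1:] s'" by (auto elim!: dvdE)
  have "smult [:- a, 1:] (smult c' q) = smult [:- a, 1:] (p * s')"
    using Suc.prems(2) unfolding s' c' by simp
  then have "smult [:- a, 1:] (smult c' q - p * s') = 0" by (simp add: smult_diff_right)
  then have "smult c' q = p * s'" by simp
  then show ?case using Suc.hyps(1) deg c'0 by blast
qed

text \<open>Pseudo-division is used because the coefficients form no field. For each
  \<open>a\<close> in \<open>A\<close> the remainder has \<open>d\<close> roots but degree below
  \<open>d\<close>, so it vanishes for infinitely many \<open>a\<close>.\<close>

lemma dvd_if_many_common_zeros:
  fixes p q :: "complex poly poly"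
  assumes p: "degree p \<le> d" "\<And>a. poly_at p a \<noteq> 0" and A: "infinite A"
    and R: "\<And>a. a \<in> A \<Longrightarrow> \<exists>R. finite R \<and> card R = d \<and> (\<forall>x\<in>R. beval p a x = 0 \<and> beval q a x = 0)"
  shows "p dvd q"
proof -
  have p0: "p \<noteq> 0" using p(2)[of 0] by (auto simp: poly_at_def)
  obtain s r where sr: "pseudo_divmod q p = (s, r)" by fastforce
  define c where "c = coeff p (degree p) ^ (Suc (degree q) - degree p)"
  have c: "c \<noteq> 0" using p0 by (simp add: c_def)
  have div: "smult c q = p * s + r" and deg: "r = 0 \<or> degree r < degree p"
    using pseudo_divmod[OF p0 sr] by (simp_all add: c_def)
  have "r = 0"
  proof (rule ccontr)
    assume "r \<noteq> 0"
    then have dr: "degree r < d" using deg p by auto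
    have "poly_at r a = 0" if "a \<in> A" for a
    proof (rule ccontr)
      assume ne: "poly_at r a \<noteq> 0"
      from R[OF that] obtain R where R: "finite R" "card R = d" "\<And>x. x \<in> R \<Longrightarrow> beval p a x = 0" "\<And>x. x \<in> R \<Longrightarrow> beval q a x = 0"
        by blast
      have "poly (poly_at r a) x = 0" if "x \<in> R" for x
        using arg_cong[OF div, of "\<lambda>p. beval p a x"] R that by (simp add: poly_poly_at)
      then have "card R \<le> card {x. poly (poly_at r a) x = 0}"
        by (intro card_mono poly_roots_finite ne) auto
      also have "\<dots> \<le> degree (poly_at r a)" by (rule card_poly_roots_bound[OF ne])
      also have "\<dots> \<le> degree r" by (rule degree_poly_at_le)
      finally show False using R dr by simp
    qed
    with A have "r = 0" by (rule poly_eq_0_if_poly_at_eq_0)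
    with \<open>r \<noteq> 0\<close> show False by simp
  qed
  with div have "smult c q = p * s" by simp
  then show ?thesis using dvd_if_dvd_smult c p(2) by blast
qed

text \<open>\<open>riley_root\<close> inverts the Moebius map, whose determinant is
  \<open>M^4 - 1\<close>.\<close>

lemma riley_root_relation:
  assumes "M \<noteq> 0" "M^4 \<noteq> 1" "y \<noteq> M^2"
  defines "l \<equiv> (1/M^2 - y) / (M^2 * y - M^4)"
  shows "1 + l * M^2 \<noteq> 0" "riley_root l M = y"
proof -
  define i where "i = 1/M^2"
  have i: "M^2 * i = 1" using assms by (simp add: i_def)
  have ne: "M^2 * y - M^4 \<noteq> 0" 
  proof
    assume "M^2 * y - M^4 = 0"
    then have "M^2 * (y - M^2) = 0" by algebra
    then show False using assms by simp
  qed
  then have l: "l * (M^2 * y - M^4) = i - y" by (simp add: l_def i_def)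
  show D: "1 + l * M^2 \<noteq> 0"
  proof
    assume "1 + l * M^2 = 0"
    with l i have "M^4 = 1" by algebra
    then show False using assms by simp
  qed
  have "y * (M^2 * (1 + l * M^2)) = 1 + l * M^6" using l i by algebra
  then show "riley_root l M = y" unfolding riley_root_def using D assms by (simp add: divide_eq_eq)
qed

text \<open>Eigenvalue pairs and roots of the Riley polynomial are related by the Moebius map
  \<open>y \<mapsto> (M\<^sup>-\<^sup>2 - y) / (M\<^sup>2 y - M\<^sup>4)\<close>.\<close>
lemma generator_of_vanishing_ideal:
  fixes p :: "complex poly poly"
  assumes deg: "degree p \<le> riley_degree n" and nz: "beval p 0 L0 \<noteq> 0"
    and eq: "\<And>L M. M \<noteq> 0 \<Longrightarrow> 1 + L * M powi (4*n) * M^2 \<noteq> 0 \<Longrightarrow>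
      beval p M L = M powi e * (1 + L * M powi (4*n) * M^2) ^ riley_degree n
         * riley n (M^2 + 1/M^2) (riley_root (L * M powi (4*n)) M)"
  shows "(\<forall>(L, M) \<in> eig_set n. beval q M L = 0) \<longleftrightarrow> p dvd q"
proof -
  have at_root: "riley n (M^2 + 1/M^2) (M^2) = (M^2) powi (- n)" if "M \<noteq> 0" for M :: complex
    using riley_at_root[of "M^2" n] that by simp
  have van: "beval p M L = 0" if LM: "(L, M) \<in> eig_set n" for L M
  proof -
    obtain y where M: "M \<noteq> 0" and r: "riley n (M^2 + 1/M^2) y = 0"
      and L: "L * M powi (4*n) * (M^2 * y - M^4) = 1/M^2 - y" using eig_set_imp[OF LM] .
    define l where "l = L * M powi (4*n)"
    define i where "i = 1/M^2"
    have i: "M^2 * i = 1" using M by (simp add: i_def)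
    have y: "y \<noteq> M^2" using r at_root[OF M] M by auto
    show ?thesis
    proof (cases "M^4 = 1")
      case False
      have "M^2 * y - M^4 = M^2 * (y - M^2)" by algebra
      then have "M^2 * y - M^4 \<noteq> 0" using M y by simp
      with L have l: "l = (1/M^2 - y) / (M^2 * y - M^4)" by (simp add: l_def eq_divide_eq)
      note riley_root_relation[OF M False y, folded l]
      then show ?thesis using eq[OF M] r by (simp add: l_def)
    next
      case True
      have inv: "i = M^2" using True i by algebra
      \<comment> \<open>For \<open>n = 0\<close> the Riley polynomial is the constant 1, so no
        eigenvalue pair exists.\<close>
      have pos: "riley_degree n > 0"
      proof (rule ccontr)
        assume "\<not> riley_degree n > 0"
        then have "n = 0" by (auto simp: riley_degree_def split: if_splits)
        then show False using r by (simp add: riley_def)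
      qed
      have D: "1 + l * M^2 = 0"
      proof -
        have "(1 + l * M^2) * (y - M^2) = 0" using L True inv unfolding l_def[symmetric] i_def[symmetric] by algebra
        then show ?thesis using y by simp
      qed
      text \<open>On the line \<open>M\<^sup>4 = 1\<close> the value of \<open>riley_root\<close> is constant, hence \<open>p\<close> is there
        a multiple of a positive power of \<open>1 + l M\<^sup>2\<close>.\<close>
      define b where "b = M powi e * (M^2) powi (- n)"
      define c where "c = M powi (4*n) * M^2"
      have c: "c \<noteq> 0" using M by (simp add: c_def)
      have line: "beval p M z = b * (1 + z * c) ^ riley_degree n" if z: "1 + z * c \<noteq> 0" for z
      proof -
        define lz where "lz = z * M powi (4*n)"
        have z': "1 + lz * M^2 \<noteq> 0" using z by (simp add: c_def lz_def mult.assoc)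
        have "M^2 * (M^2 * (1 + lz * M^2)) = 1 + lz * M^6" using True by algebra
        then have "riley_root lz M = M^2" unfolding riley_root_def using z' M by (simp add: divide_eq_eq)
        then show ?thesis using eq[OF M, of z] z' at_root[OF M]
          by (simp add: lz_def b_def c_def mult.assoc mult.left_commute)
      qed
      \<comment> \<open>Two polynomials in \<open>L\<close> that agree off the single point
        \<open>-1/c\<close> are equal.\<close>
      have "poly_at p M = smult b ([:1, c:] ^ riley_degree n)"
      proof (rule ccontr)
        assume "poly_at p M \<noteq> smult b ([:1, c:] ^ riley_degree n)"
        then have ne: "poly_at p M - smult b ([:1, c:] ^ riley_degree n) \<noteq> 0" by simp
        have "UNIV - {- 1/c} \<subseteq> {z. poly (poly_at p M - smult b ([:1, c:] ^ riley_degree n)) z = 0}"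
        proof
          fix z assume "z \<in> UNIV - {- 1/c}"
          then have "1 + z * c \<noteq> 0" using c by (auto simp: field_simps add_eq_0_iff)
          then show "z \<in> {z. poly (poly_at p M - smult b ([:1, c:] ^ riley_degree n)) z = 0}"
            using line by (simp add: poly_poly_at)
        qed
        then have "finite (UNIV - {- 1/c})" using poly_roots_finite[OF ne] finite_subset by blast
        then show False by (simp add: infinite_UNIV_char_0)
      qed
      then have "beval p M L = b * (1 + L * c) ^ riley_degree n" by (metis poly_poly_at poly_smult poly_power poly_pCons poly_0 mult_zero_right add_0_right mult.commute)
      also have "1 + L * c = 0" using D by (simp add: l_def c_def mult.assoc)
      finally show ?thesis using pos by simp
    qed
  qed
  \<comment> \<open>No factor depends on \<open>M\<close> alone: for \<open>a \<noteq> 0\<close> the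
    test point is \<open>L = 0\<close>, where \<open>riley_root\<close> is
    \<open>1/a^2\<close>.\<close>
  have nonzero: "poly_at p a \<noteq> 0" for a
  proof (cases "a = 0")
    case True
    then show ?thesis using nz by (metis poly_poly_at poly_0)
  next
    case False
    have "riley_root 0 a = 1/a^2" by (simp add: riley_root_def)
    moreover have "riley n (a^2 + 1/a^2) (1/a^2) = (1/a^2) powi (- n)"
      using riley_at_root[of "1/a^2" n] False by (simp add: add.commute)
    ultimately have "beval p a 0 \<noteq> 0" using eq[of a 0] False by simp
    then show ?thesis by (metis poly_poly_at poly_0)
  qed
  show ?thesis
  proof
    assume "p dvd q"
    then show "\<forall>(L, M) \<in> eig_set n. beval q M L = 0" using van by (auto elim!: dvdE)
  next
    assume q: "\<forall>(L, M) \<in> eig_set n. beval q M L = 0"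
    show "p dvd q"
    proof (rule dvd_if_many_common_zeros[OF deg nonzero infinite_generic_M[of n]])
      fix M assume "M \<in> {M::complex. M \<noteq> 0 \<and> M^4 \<noteq> 1 \<and>
        (\<exists>R. finite R \<and> card R = riley_degree n \<and> (\<forall>y\<in>R. riley n (M^2 + 1/M^2) y = 0))}"
      then obtain R where M: "M \<noteq> 0" "M^4 \<noteq> 1" and R: "finite R" "card R = riley_degree n" 
        "\<And>y. y \<in> R \<Longrightarrow> riley n (M^2 + 1/M^2) y = 0" by blast
      define f where "f y = (1/M^2 - y) / (M^2 * y - M^4)" for y
      define g where "g y = f y * M powi (- 4*n)" for y
      have gf: "g y * M powi (4*n) = f y" for y using M by (simp add: g_def power_int_minus)
      have y: "y \<noteq> M^2" if "y \<in> R" for y using R(3)[OF that] at_root[OF M(1)] M by auto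
      have root: "1 + f y * M^2 \<noteq> 0" "riley_root (f y) M = y" if "y \<in> R" for y
        using riley_root_relation[OF M y[OF that]] by (simp_all add: f_def)
      \<comment> \<open>The inverse Moebius map recovers \<open>y\<close>, so distinct Riley roots
        give distinct \<open>L\<close>.\<close>
      have "inj_on g R" by (rule inj_on_inverseI[of _ "\<lambda>z. riley_root (z * M powi (4*n)) M"]) (simp add: gf root)
      moreover have "(g y, M) \<in> eig_set n" if "y \<in> R" for y
      proof (rule eig_set_intro[OF M(1) _ y[OF that] R(3)[OF that]])
        show "M^2 \<noteq> 1" 
        proof
          assume "M^2 = 1"
          then have "M^4 = 1" by algebra
          then show False using M by simp
        qed
        have "M^2 * y - M^4 = M^2 * (y - M^2)" by algebra
        then have "M^2 * y - M^4 \<noteq> 0" using M y[OF that] by simp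
        then show "g y * M powi (4*n) * (M^2 * y - M^4) = 1/M^2 - y"
          unfolding gf f_def by simp
      qed
      ultimately show "\<exists>R. finite R \<and> card R = riley_degree n \<and> (\<forall>x\<in>R. beval p M x = 0 \<and> beval q M x = 0)"
        using R van q by (intro exI[of _ "g ` R"]) (force simp: card_image)
    qed
  qed
qed

section \<open>Polynomiality of the formula\<close>

text \<open>Polynomial functions of \<open>(z, M)\<close> of degree at most \<open>d\<close> in \<open>z\<close>; the roles of the variables
  are swapped with respect to the polynomial \<open>P\<close> of the theorem.\<close>
definition is_bipoly :: "nat \<Rightarrow> (complex \<Rightarrow> complex \<Rightarrow> complex) \<Rightarrow> bool" where
  "is_bipoly d f \<longleftrightarrow> (\<exists>p. degree p \<le> d \<and> (\<forall>z M. f z M = beval p M z))"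

lemma is_bipoly_mono: "is_bipoly d f \<Longrightarrow> d \<le> d' \<Longrightarrow> is_bipoly d' f"
  unfolding is_bipoly_def using order_trans by blast

lemma is_bipoly_poly: "is_bipoly d (\<lambda>z M. poly c M)"
  unfolding is_bipoly_def by (intro exI[of _ "[:c:]"]) simp

lemma is_bipoly_const: "is_bipoly d (\<lambda>z M. a)"
  using is_bipoly_poly[of d "[:a:]"] by simp

lemma is_bipoly_power_M: "is_bipoly d (\<lambda>z M. M ^ k)"
  using is_bipoly_poly[of d "monom 1 k"] by (simp add: poly_monom)

lemma is_bipoly_var: "is_bipoly (Suc d) (\<lambda>z M. z)"
  unfolding is_bipoly_def by (intro exI[of _ "[:0, 1:]"]) simp

lemma is_bipoly_add: "is_bipoly d f \<Longrightarrow> is_bipoly d g \<Longrightarrow> is_bipoly d (\<lambda>z M. f z M + g z M)"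
  unfolding is_bipoly_def by (metis beval_simps(3) degree_add_le)

lemma is_bipoly_diff: "is_bipoly d f \<Longrightarrow> is_bipoly d g \<Longrightarrow> is_bipoly d (\<lambda>z M. f z M - g z M)"
  unfolding is_bipoly_def by (metis beval_simps(4) degree_diff_le)

lemma is_bipoly_mult: "is_bipoly d f \<Longrightarrow> is_bipoly e g \<Longrightarrow> is_bipoly (d + e) (\<lambda>z M. f z M * g z M)"
  unfolding is_bipoly_def by (metis beval_simps(5) degree_mult_le add_mono order_trans)

lemma is_bipoly_power: "is_bipoly d f \<Longrightarrow> is_bipoly (d * k) (\<lambda>z M. f z M ^ k)"
proof (induction k)
  case 0
  then show ?case using is_bipoly_const[of 0 1] by simp
next
  case (Suc k)
  then show ?case using is_bipoly_mult[of d f "d * k" "\<lambda>z M. f z M ^ k"] by simp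
qed

lemma is_bipoly_sum:
  assumes "finite A" "\<And>a. a \<in> A \<Longrightarrow> is_bipoly d (f a)"
  shows "is_bipoly d (\<lambda>z M. \<Sum>a\<in>A. f a z M)"
  using assms
proof (induction A rule: finite_induct)
  case empty
  then show ?case using is_bipoly_const[of d 0] by simp
next
  case (insert a A)
  then show ?case using is_bipoly_add[of d "f a" "\<lambda>z M. \<Sum>a\<in>A. f a z M"] by simp
qed

lemma riley_at_zero: "M \<noteq> 0 \<Longrightarrow> riley n (M^2 + 1/M^2) (1/M^2) = (M^2) powi n" for M :: complex
  using riley_at_root[of "1/M^2" n] by (simp add: add.commute power_int_minus power_int_divide_distrib)

text \<open>The hypotheses of \<open>generator_of_vanishing_ideal\<close>; nonvanishing at
  \<open>M = 0\<close> says that \<open>M\<close> is not a factor.\<close>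

definition bipoly_for :: "int \<Rightarrow> (complex \<Rightarrow> complex \<Rightarrow> complex) \<Rightarrow> bool" where
  "bipoly_for n f \<longleftrightarrow> is_bipoly (riley_degree n) f \<and> (\<exists>L. f L 0 \<noteq> 0) \<and>
     (\<forall>L M. M \<noteq> 0 \<longrightarrow> 1 + L * M powi (4*n) * M^2 \<noteq> 0 \<longrightarrow>
      f L M = M powi prefactor_exp n * (1 + L * M powi (4*n) * M^2) ^ riley_degree n
         * riley n (M^2 + 1/M^2) (riley_root (L * M powi (4*n)) M))"

text \<open>Only powers \<open>M\<^bsup>-4n\<^esup>\<close> occur as denominators when the formula is expanded in \<open>l = L M\<^bsup>4n\<^esup>\<close>,
  and the constant term is \<open>1\<close>.\<close>
lemma bipoly_for_nonneg:
  assumes "n \<ge> 0"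
  shows "\<exists>f. bipoly_for n f"
proof -
  define k where "k = nat n"
  have n: "n = int k" using assms by (simp add: k_def)
  have d: "riley_degree n = 3 * k" by (simp add: n riley_degree_def)
  define b where "b i = (1 + i) div 2" for i :: nat
  \<comment> \<open>These bounds make the natural-number subtractions in \<open>F\<close> exact;
    \<open>F\<close> is the sum multiplied by \<open>M^(2k) (1 + z M^2)^(3k)\<close>.\<close>
  have b: "b i \<le> k" "i + b i \<le> 3 * k" if "i \<le> 2*k" for i using that by (auto simp: b_def)
  define F where "F z M = (\<Sum>i\<le>2*k. of_nat ((k + i div 2) choose i) * ((z - 1) * (1 - M^2)) ^ i
     * (1 + z * M^6) ^ b i * M ^ (2*(k - b i)) * (1 + z * M^2) ^ (3*k - i - b i))" for z M :: complex
  have "is_bipoly (3*k) (\<lambda>z M. of_nat ((k + i div 2) choose i) * ((z - 1) * (1 - M^2)) ^ i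
     * (1 + z * M^6) ^ b i * M ^ (2*(k - b i)) * (1 + z * M^2) ^ (3*k - i - b i))" if "i \<le> 2*k" for i
  proof -
    have 1: "is_bipoly (1 + 0) (\<lambda>z M. (z - 1) * (1 - M^2))"
      by (intro is_bipoly_mult is_bipoly_diff is_bipoly_const is_bipoly_power_M)
         (use is_bipoly_var[of 0] in simp)
    have 2: "is_bipoly (1 + 0) (\<lambda>z M. 1 + z * M^j)" for j
      by (intro is_bipoly_add is_bipoly_mult is_bipoly_const is_bipoly_power_M)
         (use is_bipoly_var[of 0] in simp)
    have "is_bipoly (0 + (1 + 0) * i + (1 + 0) * b i + 0 + (1 + 0) * (3*k - i - b i)) (\<lambda>z M. of_nat ((k + i div 2) choose i) * ((z - 1) * (1 - M^2)) ^ i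
     * (1 + z * M^6) ^ b i * M ^ (2*(k - b i)) * (1 + z * M^2) ^ (3*k - i - b i))"
      by (intro is_bipoly_mult is_bipoly_power is_bipoly_const is_bipoly_power_M 1 2)
    then show ?thesis by (rule is_bipoly_mono) (use b[OF that] in simp)
  qed
  then have "is_bipoly (3*k) F" unfolding F_def by (intro is_bipoly_sum) auto
  then obtain c where c: "\<And>z M. F z M = (\<Sum>j\<le>3*k. poly (c j) M * z ^ j)"
    unfolding is_bipoly_def by (metis beval_eq_sum)
  have F: "F z M = M ^ (2*k) * (1 + z * M^2) ^ (3*k) * riley n (M^2 + 1/M^2) (riley_root z M)"
    if M: "M \<noteq> 0" and D: "1 + z * M^2 \<noteq> 0" for z M
  proof -
    have "F z M = (\<Sum>i\<le>2*k. M ^ (2*k) * (1 + z * M^2) ^ (3*k) * (of_nat ((k + i div 2) choose i)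
      * ((z - 1) * (1 - M^2) / (1 + z * M^2)) ^ i * riley_root z M ^ ((1 + i) div 2)))"
      unfolding F_def
    proof (intro sum.cong refl)
      fix i assume "i \<in> {..2*k}"
      then have i: "i \<le> 2*k" by simp
      have Dp: "(1 + z * M^2) ^ (3*k) = (1 + z * M^2) ^ (3*k - i - b i) * (1 + z * M^2) ^ i * (1 + z * M^2) ^ b i"
        using b[OF i] by (simp flip: power_add)
      have Mp: "M ^ (2*k) = M ^ (2*(k - b i)) * (M^2) ^ b i"
      proof -
        have "2*k = 2*(k - b i) + 2 * b i" using b[OF i] by simp
        then show ?thesis by (metis power_add power_mult)
      qed
      show "of_nat ((k + i div 2) choose i) * ((z - 1) * (1 - M^2)) ^ i
        * (1 + z * M^6) ^ b i * M ^ (2*(k - b i)) * (1 + z * M^2) ^ (3*k - i - b i)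
        = M ^ (2*k) * (1 + z * M^2) ^ (3*k) * (of_nat ((k + i div 2) choose i)
      * ((z - 1) * (1 - M^2) / (1 + z * M^2)) ^ i * riley_root z M ^ ((1 + i) div 2))"
        unfolding b_def[symmetric] Dp Mp riley_root_def power_divide power_mult_distrib using M D by simp
    qed
    also have "\<dots> = M ^ (2*k) * (1 + z * M^2) ^ (3*k) * riley n (M^2 + 1/M^2) (riley_root z M)"
      unfolding n riley_sum_nonneg[symmetric] riley_root_X[OF M D] by (simp only: sum_distrib_left)
    finally show ?thesis .
  qed
  have c0: "poly (c 0) M = M ^ (4*k)" if "M \<noteq> 0" for M
  proof -
    have "poly (c 0) M = F 0 M" by (simp add: c power_0_left if_distrib cong: if_cong)
    also have "\<dots> = M ^ (2*k) * M ^ (2*k)"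
      using F[OF that, of 0] riley_at_zero[OF that, of n]
      by (simp add: riley_root_def n power_int_def flip: power_mult)
    finally show ?thesis by (simp flip: power_add)
  qed
  \<comment> \<open>This is \<open>F\<close> at \<open>z = L M^(4k)\<close> divided by
    \<open>M^(4k)\<close>, which is its constant term.\<close>
  define f where "f L M = 1 + (\<Sum>j\<in>{1..3*k}. poly (c j) M * M ^ (4*k*(j-1)) * L ^ j)" for L M
  have "is_bipoly (3*k) f" unfolding f_def
  proof (intro is_bipoly_add is_bipoly_const is_bipoly_sum)
    fix j assume j: "j \<in> {1..3*k}"
    have "is_bipoly (0 + 0 + 1 * j) (\<lambda>L M. poly (c j) M * M ^ (4*k*(j-1)) * L ^ j)"
      by (intro is_bipoly_mult is_bipoly_poly is_bipoly_power_M is_bipoly_power)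
        (use is_bipoly_var[of 0] in simp)
    then show "is_bipoly (3*k) (\<lambda>L M. poly (c j) M * M ^ (4*k*(j-1)) * L ^ j)"
      by (rule is_bipoly_mono) (use j in simp)
  qed simp
  moreover have "\<exists>L. f L 0 \<noteq> 0" by (intro exI[of _ 0]) (simp add: f_def)
  moreover have "f L M = M powi prefactor_exp n * (1 + L * M powi (4*n) * M^2) ^ riley_degree n
         * riley n (M^2 + 1/M^2) (riley_root (L * M powi (4*n)) M)"
    if M: "M \<noteq> 0" and D: "1 + L * M powi (4*n) * M^2 \<noteq> 0" for L M
  proof -
    define z where "z = L * M powi (4*n)"
    have z: "z = L * M ^ (4*k)" by (simp add: z_def n power_int_def nat_mult_distrib)
    have "M ^ (4*k) * f L M = M ^ (4*k) + (\<Sum>j\<in>{1..3*k}. poly (c j) M * z ^ j)"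
    proof -
      have "M ^ (4*k) * (poly (c j) M * M ^ (4*k*(j-1)) * L ^ j) = poly (c j) M * z ^ j" if j: "j \<in> {1..3*k}" for j
      proof -
        obtain i where i: "j = Suc i" using j by (cases j) auto
        show ?thesis by (simp add: z i power_mult_distrib power_mult power_add)
      qed
      then show ?thesis unfolding f_def distrib_left sum_distrib_left by (simp only: mult_1_right cong: sum.cong)
    qed
    also have "\<dots> = F z M"
    proof -
      have "{..3*k} = insert 0 {1..3*k}" by auto
      then show ?thesis by (simp add: c c0[OF M])
    qed
    also have "\<dots> = M ^ (2*k) * (1 + z * M^2) ^ (3*k) * riley n (M^2 + 1/M^2) (riley_root z M)"
      using F[OF M] D by (simp add: z_def)
    also have "M ^ (2*k) = M ^ (4*k) * M powi prefactor_exp n"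
    proof -
      have "int (2*k) = int (4*k) + prefactor_exp n" by (simp add: prefactor_exp_def n)
      then show ?thesis using M by (metis power_int_add power_int_of_nat)
    qed
    finally show ?thesis using M by (simp add: z_def d)
  qed
  ultimately show ?thesis unfolding bipoly_for_def d by blast
qed

text \<open>Separate because the expansion for \<open>n < -1\<close> uses \<open>M^(4k - 6)\<close>
  with \<open>k = -n\<close>, a negative exponent at \<open>k = 1\<close>. The polynomial is that of
  the figure-eight knot.\<close>

lemma bipoly_for_minus_one: "\<exists>f. bipoly_for (-1) f"
proof -
  define f :: "complex \<Rightarrow> complex \<Rightarrow> complex" where
    "f L M = L^2 * M^4 + L * (2 * M^4 + M^2 + M^6 - 1 - M^8) + M^4" for L M
  have d: "riley_degree (-1) = 2" by (simp add: riley_degree_def)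
  have "is_bipoly 2 f"
  proof -
    have v: "is_bipoly 1 (\<lambda>L M. L)" using is_bipoly_var[of 0] by simp
    have "is_bipoly (1 * 2 + 0) (\<lambda>L M. L^2 * M^4)"
      by (intro is_bipoly_mult is_bipoly_power is_bipoly_power_M v)
    moreover have "is_bipoly (1 + 0) (\<lambda>L M. L * (2 * M^4 + M^2 + M^6 - 1 - M^8))"
      by (intro is_bipoly_mult[OF v] is_bipoly_add is_bipoly_diff is_bipoly_mult[of 0 _ 0, simplified] is_bipoly_power_M is_bipoly_const)
    ultimately show ?thesis unfolding f_def
      by (intro is_bipoly_add is_bipoly_power_M) (auto elim: is_bipoly_mono)
  qed
  moreover have "\<exists>L. f L 0 \<noteq> 0" by (intro exI[of _ 1]) (simp add: f_def)
  moreover have "f L M = M powi prefactor_exp (-1) * (1 + L * M powi (4*(-1)) * M^2) ^ 2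
         * riley (-1) (M^2 + 1/M^2) (riley_root (L * M powi (4*(-1))) M)"
    if M: "M \<noteq> 0" and D: "1 + L * M powi (4*(-1)) * M^2 \<noteq> 0" for L M
  proof -
    define z where "z = L * M powi (4*(-1))"
    have L: "L = z * M^4" using M by (simp add: z_def power_int_minus)
    have D: "1 + z * M^2 \<noteq> 0" using D by (simp add: z_def)
    define X y where "X = M^2 + 1/M^2 - 1 - riley_root z M" and "y = riley_root z M"
    have r: "riley (-1) (M^2 + 1/M^2) y = 1 - X * y"
      by (simp add: riley_def X_def y_def cheb_def)
    have X: "X * (1 + z * M^2) = (z - 1) * (1 - M^2)"
      unfolding X_def riley_root_X[OF M D] using D by simp
    have y: "y * (M^2 * (1 + z * M^2)) = 1 + z * M^6"
      unfolding y_def riley_root_def using D M by simp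
    have "f L M = M^6 * (1 + z * M^2)^2 * (1 - X * y)"
      unfolding f_def L using X y by algebra
    then show ?thesis unfolding z_def[symmetric] y_def[symmetric] r by (simp add: prefactor_exp_def)
  qed
  ultimately show ?thesis unfolding bipoly_for_def d by blast
qed

text \<open>For \<open>n < -1\<close> one expands at \<open>l = \<infinity>\<close> instead: in terms of \<open>r = 1 / (M\<^sup>4 (1 + l M\<^sup>2))\<close> the factors
  become \<open>x - 1 - y = M\<^sup>-\<^sup>2 a\<close> and \<open>y = M\<^sup>2 b\<close> with polynomials \<open>a\<close>, \<open>b\<close>.\<close>
lemma bipoly_for_neg:
  assumes "n < -1"
  shows "\<exists>f. bipoly_for n f"
proof -
  define k where "k = nat (- n)"
  have n: "n = - int k" "k \<ge> 2" using assms by (auto simp: k_def)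
  define d where "d = 3 * k - 1"
  have d: "riley_degree n = d" "d \<ge> 1" using n by (auto simp: d_def riley_degree_def)
  define b where "b i = (1 + i) div 2" for i :: nat
  define A :: "complex \<Rightarrow> complex \<Rightarrow> complex" where "A r M = 1 - M^2 - r * (M^4 * (1 - M^4))" for r M
  define B :: "complex \<Rightarrow> complex \<Rightarrow> complex" where "B r M = 1 + r * (1 - M^4)" for r M
  define C :: "nat \<Rightarrow> complex" where "C i = of_nat (nat (int k + (int i - 1) div 2) choose i)" for i
  define F where "F r M = (\<Sum>i<2*k. C i * (- A r M) ^ i * B r M ^ b i * M ^ (2*(k - 1 - i div 2)))" for r M
  have "is_bipoly d (\<lambda>r M. C i * (- A r M) ^ i * B r M ^ b i * M ^ (2*(k - 1 - i div 2)))" if "i < 2*k" for i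
  proof -
    have v: "is_bipoly 1 (\<lambda>L M. L)" using is_bipoly_var[of 0] by simp
    have "is_bipoly (1 + (0 + 0)) (\<lambda>r M. 0 - (1 - M^2 - r * (M^4 * (1 - M^4))))"
      by (intro is_bipoly_diff is_bipoly_mult v is_bipoly_power_M is_bipoly_const)
    then have 1: "is_bipoly 1 (\<lambda>r M. - A r M)" by (simp add: A_def)
    have "is_bipoly (1 + 0) B" unfolding B_def
      by (intro is_bipoly_add is_bipoly_diff is_bipoly_mult v is_bipoly_power_M is_bipoly_const)
    then have 2: "is_bipoly 1 B" by simp
    have "is_bipoly (0 + 1 * i + 1 * b i + 0) (\<lambda>r M. C i * (- A r M) ^ i * B r M ^ b i * M ^ (2*(k - 1 - i div 2)))"
      by (intro is_bipoly_mult is_bipoly_power is_bipoly_const is_bipoly_power_M 1 2)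
    then show ?thesis by (rule is_bipoly_mono) (use that in \<open>auto simp: b_def d_def\<close>)
  qed
  then have "is_bipoly d F" unfolding F_def by (intro is_bipoly_sum) auto
  then obtain p where p: "degree p \<le> d" "\<And>r M. F r M = beval p M r" unfolding is_bipoly_def by blast
  define c where "c = coeff p"
  have c: "F r M = (\<Sum>j\<le>d. poly (c j) M * r ^ j)" for r M
    by (simp only: p(2) c_def beval_eq_sum[OF p(1)])
  have F: "F r M = M ^ (2*k - 2) * riley n (M^2 + 1/M^2) (M^2 * B r M)" if M: "M \<noteq> 0" for r M
  proof -
    have X: "- (M^2 + 1/M^2 - 1 - M^2 * B r M) = - A r M / M^2"
    proof -
      have "- (M^2 + 1/M^2 - 1 - M^2 * B r M) * M^2 = - A r M"
        using M by (simp add: A_def B_def divide_simps) algebra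
      with _ show ?thesis by (rule eq_divide_imp) (use M in simp)
    qed
    have "F r M = (\<Sum>i<2*k. M ^ (2*k - 2) * (C i * (- A r M / M^2) ^ i * (M^2 * B r M) ^ ((1 + i) div 2)))"
      unfolding F_def
    proof (intro sum.cong refl)
      fix i assume "i \<in> {..<2*k}"
      then have i: "i div 2 \<le> k - 1" by auto
      have "2*k - 2 = 2 * (k - 1 - i div 2) + 2 * (i div 2)" using i by simp
      moreover have "2 * (i div 2) + 2 * b i = 2 * i" unfolding b_def by presburger
      ultimately have "2*k - 2 + 2 * b i = 2*(k - 1 - i div 2) + 2 * i" by linarith
      then have "M ^ (2*k - 2) * (M^2) ^ b i = M ^ (2*(k - 1 - i div 2)) * (M^2) ^ i"
        by (metis power_add power_mult)
      then have eq: "M ^ (2*(k - 1 - i div 2)) = M ^ (2*k - 2) * (M^2) ^ b i / (M^2) ^ i"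
        using M by simp
      show "C i * (- A r M) ^ i * B r M ^ b i * M ^ (2*(k - 1 - i div 2))
        = M ^ (2*k - 2) * (C i * (- A r M / M^2) ^ i * (M^2 * B r M) ^ ((1 + i) div 2))"
        unfolding b_def[symmetric] power_mult_distrib power_divide eq by (simp add: mult_ac)
    qed
    also have "\<dots> = M ^ (2*k - 2) * riley n (M^2 + 1/M^2) (M^2 * B r M)"
    proof -
      have "k > 0" using n(2) by simp
      from riley_sum_neg[OF this, of "M^2 + 1/M^2" "M^2 * B r M"] show ?thesis
        unfolding X n(1) C_def by (simp only: sum_distrib_left[symmetric])
    qed
    finally show ?thesis .
  qed
  \<comment> \<open>\<open>r = 0\<close> means \<open>y = M^2\<close>, where
    \<open>riley_at_root\<close> applies.\<close>
  have c0: "poly (c 0) M = M ^ (4*k - 2)" if M: "M \<noteq> 0" for M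
  proof -
    have "poly (c 0) M = F 0 M" by (simp add: c power_0_left if_distrib cong: if_cong)
    also have "\<dots> = M ^ (2*k - 2) * M ^ (2*k)"
      using F[OF that, of 0] riley_at_root[of "M^2" n] M
      by (simp add: B_def n power_int_def flip: power_mult)
    also have "\<dots> = M ^ (4*k - 2)" using n(2) by (simp flip: power_add)
    finally show ?thesis .
  qed
  \<comment> \<open>At \<open>M = 0\<close> only the two largest indices survive, leaving
    \<open>- r (1 + r)^(k-1)\<close>.\<close>
  have c1: "poly (c 1) 0 = -1"
  proof -
    obtain l where l: "k = Suc l" using n(2) by (cases k) auto
    have "F r 0 = - r * (1 + r) ^ l" for r
    proof -
      have "F r 0 = (\<Sum>i<2*k. if i \<in> {2*l, 2*l+1} then C i * (-1) ^ i * (1 + r) ^ b i else 0)"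
        unfolding F_def by (intro sum.cong refl) (auto simp: A_def B_def l power_0_left)
      also have "\<dots> = (\<Sum>i\<in>{2*l, 2*l+1}. C i * (-1) ^ i * (1 + r) ^ b i)"
        by (subst sum.inter_restrict[symmetric]) (auto simp: l intro!: sum.cong)
      also have "\<dots> = (1 + r) ^ l - (1 + r) ^ (l + 1)"
      proof -
        have "(2 * int l - 1) div 2 = int l - 1" by linarith
        moreover have "nat (int l + int l) = 2 * l" "nat (1 + (int l + int l)) = Suc (2 * l)" by auto
        ultimately have "C (2*l) = 1" "C (2*l+1) = 1" by (simp_all add: C_def l add_ac)
        moreover have "b (2*l) = l" "b (2*l+1) = l+1" by (simp_all add: b_def)
        ultimately show ?thesis by simp
      qed
      finally show ?thesis by (simp add: algebra_simps)
    qed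
    then have "poly_at p 0 = - ([:0, 1:] * [:1, 1:] ^ l)"
      by (intro poly_ext) (simp add: poly_poly_at p(2)[symmetric])
    then have "poly (c 1) 0 = coeff (- ([:0, 1:] * [:1, 1:] ^ l) :: complex poly) 1"
      by (simp add: c_def flip: coeff_poly_at)
    also have "\<dots> = -1" by (simp add: coeff_0_power)
    finally show ?thesis .
  qed
  \<comment> \<open>\<open>E\<close> is \<open>M^(4k-2) (1 + l M^2)\<close>, so
    \<open>r = M^(4k-6) / E\<close>, and \<open>f\<close> below is \<open>E^d F\<close> divided by
    \<open>M^(4k-6)\<close>.\<close>
  define E :: "complex \<Rightarrow> complex \<Rightarrow> complex" where "E L M = L + M ^ (4*k - 2)" for L M
  define f where "f L M = M^4 * E L M ^ d + (\<Sum>j\<in>{1..d}. poly (c j) M * M ^ ((4*k - 6)*(j-1)) * E L M ^ (d - j))" for L M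
  have Ebi: "is_bipoly 1 E" unfolding E_def
    by (intro is_bipoly_add is_bipoly_power_M) (use is_bipoly_var[of 0] in simp)
  have "is_bipoly d f" unfolding f_def
  proof (intro is_bipoly_add is_bipoly_sum)
    have "is_bipoly (0 + 1 * d) (\<lambda>L M. M^4 * E L M ^ d)"
      by (intro is_bipoly_mult is_bipoly_power is_bipoly_power_M Ebi)
    then show "is_bipoly d (\<lambda>L M. M^4 * E L M ^ d)" by simp
  next
    fix j assume j: "j \<in> {1..d}"
    have "is_bipoly (0 + 0 + 1 * (d - j)) (\<lambda>L M. poly (c j) M * M ^ ((4*k - 6)*(j-1)) * E L M ^ (d - j))"
      by (intro is_bipoly_mult is_bipoly_poly is_bipoly_power_M is_bipoly_power Ebi)
    then show "is_bipoly d (\<lambda>L M. poly (c j) M * M ^ ((4*k - 6)*(j-1)) * E L M ^ (d - j))"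
      by (rule is_bipoly_mono) (use j in simp)
  qed simp
  \<comment> \<open>As \<open>4k - 6 > 0\<close>, only the term \<open>j = 1\<close> remains at
    \<open>M = 0\<close>, and \<open>c1\<close> gives its value.\<close>
  moreover have "f 1 0 \<noteq> 0"
  proof -
    have "4*k - 2 > 0" using n(2) by simp
    then have "E 1 0 = 1" by (simp add: E_def del: zero_less_diff)
    then have "f 1 0 = (\<Sum>j\<in>{1..d}. poly (c j) 0 * 0 ^ ((4*k - 6)*(j-1)))"
      by (simp add: f_def)
    also have "\<dots> = (\<Sum>j\<in>{1..d}. if j = 1 then poly (c 1) 0 else 0)"
      using n(2) by (intro sum.cong) (auto simp: power_0_left)
    finally have "f 1 0 = (\<Sum>j\<in>{1..d}. if j = 1 then poly (c 1) 0 else 0)" .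
    then show ?thesis using c1 d(2) by simp
  qed
  moreover have "f L M = M powi prefactor_exp n * (1 + L * M powi (4*n) * M^2) ^ riley_degree n
         * riley n (M^2 + 1/M^2) (riley_root (L * M powi (4*n)) M)"
    if M: "M \<noteq> 0" and D': "1 + L * M powi (4*n) * M^2 \<noteq> 0" for L M
  proof -
    define z where "z = L * M powi (4*n)"
    define e where "e = E L M"
    have D: "1 + z * M^2 \<noteq> 0" using D' by (simp add: z_def)
    have "4*n = - int (4*k)" by (simp add: n(1))
    then have "M powi (4*n) = inverse (M ^ (4*k))" by (simp only: power_int_minus power_int_of_nat)
    then have L: "L = z * M ^ (4*k)" using M by (simp add: z_def)
    have k4: "4*k = (4*k - 2) + 2" "4*k - 2 = (4*k - 6) + 4" using n(2) by auto
    have e: "e = M ^ (4*k - 2) * (1 + z * M^2)"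
      unfolding e_def E_def L by (subst k4(1)) (simp add: power_add power2_eq_square algebra_simps)
    then have e0: "e \<noteq> 0" using M D by simp
    define r where "r = M ^ (4*k - 6) / e"
    have r: "r * (M^4 * (1 + z * M^2)) = 1"
      unfolding r_def e by (subst k4(2)) (use M D in \<open>simp add: power_add\<close>)
    have y: "M^2 * B r M = riley_root z M"
    proof -
      have "M^2 * B r M * (M^2 * (1 + z * M^2)) = 1 + z * M^6" unfolding B_def using r by algebra
      then show ?thesis unfolding riley_root_def using M D by (simp add: eq_divide_eq)
    qed
    have "M ^ (4*k - 6) * f L M = e ^ d * F r M"
    proof -
      have "{..d} = insert 0 {1..d}" by auto
      then have "e ^ d * F r M = e ^ d * M ^ (4*k - 2) + (\<Sum>j\<in>{1..d}. e ^ d * (poly (c j) M * r ^ j))"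
        by (simp add: c c0[OF M] distrib_left sum_distrib_left)
      also have "e ^ d * M ^ (4*k - 2) = M ^ (4*k - 6) * (M^4 * e ^ d)"
        by (subst k4(2)) (simp add: power_add)
      also have "(\<Sum>j\<in>{1..d}. e ^ d * (poly (c j) M * r ^ j))
        = (\<Sum>j\<in>{1..d}. M ^ (4*k - 6) * (poly (c j) M * M ^ ((4*k - 6)*(j-1)) * e ^ (d - j)))"
      proof (intro sum.cong refl)
        fix j assume j: "j \<in> {1..d}"
        obtain i where i: "j = Suc i" using j by (cases j) auto
        have "e ^ d = e ^ (d - j) * e ^ j" using j by (simp flip: power_add)
        then have "e ^ d * r ^ j = e ^ (d - j) * (M ^ (4*k - 6)) ^ j"
          using e0 by (simp add: r_def power_divide)
        also have "(M ^ (4*k - 6)) ^ j = M ^ (4*k - 6) * M ^ ((4*k - 6)*(j-1))"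
          by (simp add: i power_mult)
        finally show "e ^ d * (poly (c j) M * r ^ j) = M ^ (4*k - 6) * (poly (c j) M * M ^ ((4*k - 6)*(j-1)) * e ^ (d - j))"
          by (simp add: mult_ac)
      qed
      finally show ?thesis by (simp add: f_def e_def distrib_left sum_distrib_left)
    qed
    also have "\<dots> = M ^ ((4*k - 2) * d + (2*k - 2)) * (1 + z * M^2) ^ d * riley n (M^2 + 1/M^2) (riley_root z M)"
      unfolding F[OF M] y e by (simp add: power_mult_distrib power_add flip: power_mult)
    also have "M ^ ((4*k - 2) * d + (2*k - 2)) = M ^ (4*k - 6) * M powi prefactor_exp n"
    proof -
      obtain l where l: "k = l + 2" using n(2) by (metis le_add_diff_inverse2)
      have "int ((4*k - 2) * d + (2*k - 2)) = int (4*k - 6) + prefactor_exp n"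
        by (simp add: prefactor_exp_def n d_def l power2_eq_square algebra_simps)
      then show ?thesis using M by (metis power_int_add power_int_of_nat)
    qed
    finally show ?thesis using M by (simp add: z_def d)
  qed
  ultimately show ?thesis unfolding bipoly_for_def d by blast
qed

theorem theorem1:
  fixes n :: int
  shows "\<exists>P :: complex poly poly.
           (\<forall>L M. formula_defined n L M \<longrightarrow> beval P L M = A_formula n L M)
         \<and> is_A_polynomial n P"
proof -
  have "\<exists>f. bipoly_for n f"
    using bipoly_for_nonneg[of n] bipoly_for_minus_one bipoly_for_neg[of n] by (cases "n = -1"; cases "n \<ge> 0") auto
  then obtain p L0 where p: "degree p \<le> riley_degree n" "beval p 0 L0 \<noteq> 0"
    and eq: "\<And>L M. M \<noteq> 0 \<Longrightarrow> 1 + L * M powi (4*n) * M^2 \<noteq> 0 \<Longrightarrow>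
      beval p M L = M powi prefactor_exp n * (1 + L * M powi (4*n) * M^2) ^ riley_degree n
         * riley n (M^2 + 1/M^2) (riley_root (L * M powi (4*n)) M)"
    unfolding bipoly_for_def is_bipoly_def by metis
  \<comment> \<open>Exchanging the variables preserves products, so divisibility transfers in both
    directions.\<close>
  obtain P where P: "\<And>L M. beval P L M = beval p M L" using ex_swapped_poly[of p] by blast
  have "is_A_polynomial n P"
    unfolding is_A_polynomial_def
  proof
    fix Q
    obtain q where q: "\<And>L M. beval q L M = beval Q M L" using ex_swapped_poly[of Q] by blast
    have "(\<forall>(L, M) \<in> eig_set n. beval Q L M = 0) \<longleftrightarrow> p dvd q"
      using generator_of_vanishing_ideal[OF p eq, of q] by (simp add: q)
    also have "p dvd q \<longleftrightarrow> P dvd Q"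
    proof
      assume "p dvd q"
      then obtain s where s: "q = p * s" by (elim dvdE)
      obtain s' where s': "\<And>L M. beval s' L M = beval s M L" using ex_swapped_poly[of s] by blast
      have "Q = P * s'" by (rule beval_eqI) (simp add: P s' flip: q, simp add: s)
      then show "P dvd Q" by (rule dvdI)
    next
      assume "P dvd Q"
      then obtain s where s: "Q = P * s" by (elim dvdE)
      obtain s' where s': "\<And>L M. beval s' L M = beval s M L" using ex_swapped_poly[of s] by blast
      have "q = p * s'" by (rule beval_eqI) (simp add: q s P s')
      then show "p dvd q" by (rule dvdI)
    qed
    finally show "(\<forall>(L, M) \<in> eig_set n. beval Q L M = 0) \<longleftrightarrow> P dvd Q" .
  qed
  moreover have "beval P L M = A_formula n L M" if "formula_defined n L M" for L M
    using that eq[of M L] A_formula_eq_riley[of M L n] by (simp add: P formula_defined_iff)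
  ultimately show ?thesis by blast
qed

end
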